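(* For indexed forests $F,G$, the coefficients $c^H_{F,G}(\mathbf t)\in\mathbb Z[\mathbf t]$ in the expansion $$\mathfrak P_F(\mathbf x;\mathbf t)\,\mathfrak P_G(\mathbf x;\mathbf t)=\sum_H c^H_{F,G}(\mathbf t)\,\mathfrak P_H(\mathbf x;\mathbf t)$$ are Graham-positive, i.e. lie in $\mathbb Z_{\ge0}[t_2-t_1,t_3-t_2,\dots]$.
   Context: $\mathbf x=(x_1,x_2,\dots)$, $\mathbf t=(t_1,t_2,\dots)$. Indexed forests: sequences $F=(T_1,T_2,\dots)$ of binary plane trees (each node a leaf or an internal node with ordered left/right children), all but finitely many one-node trees; leaves identified with $\mathbb N$ left to right; $\emptyset$ has no internal nodes. $\rho_F(v)$: leaf reached from internal node $v$ going repeatedly to left children; terminal: both children leaves; $\mathrm{Qdes}(F)=\{\rho_F(v):v\text{ terminal}\}$; $F/i$ deletes the terminal node with $\rho_F(v)=i$ (replacing it and its leaves by one leaf, relabeling). Double forest polynomials: $R_i^-f=f(x_1,\dots,x_{i-1},t_i,x_i,\dots;\mathbf t)$, $R_i^+f=f(x_1,\dots,x_i,t_i,x_{i+1},\dots;\mathbf t)$, $E_if=(R_i^+f-R_i^-f)/(x_i-t_i)$; $\mathfrak P_F$ is the unique homogeneous family ($\deg x_i=\deg t_i=1$) with $\mathfrak P_F(\mathbf t;\mathbf t)=\delta_{F,\emptyset}$ and $E_i\mathfrak P_F=\mathfrak P_{F/i}(\mathbf x;\widehat{\mathbf t}_i)$ if $i\in\mathrm{Qdes}(F)$, else $0$, $\widehat{\mathbf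 t}_i=(t_1,\dots,t_{i-1},t_{i+1},\dots)$. These form a $\mathbb Z[\mathbf t]$-basis of $\mathbb Z[\mathbf t][\mathbf x]$. *)

theory Defs
  imports Main "HOL-Library.Poly_Mapping"
begin

type_synonym 'v mpoly = "('v \<Rightarrow>\<^sub>0 nat) \<Rightarrow>\<^sub>0 int"

definition mconst :: "int \<Rightarrow> 'v mpoly" where
  "mconst c = Poly_Mapping.single 0 c"

definition mvar :: "'v \<Rightarrow> 'v mpoly" where
  "mvar v = Poly_Mapping.single (Poly_Mapping.single v 1) 1"

definition msubst :: "('v \<Rightarrow> 'w mpoly) \<Rightarrow> 'v mpoly \<Rightarrow> 'w mpoly" where
  "msubst \<sigma> p = (\<Sum>m\<in>Poly_Mapping.keys p. mconst (Poly_Mapping.lookup p m) *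
                      (\<Prod>v\<in>Poly_Mapping.keys (m :: 'v \<Rightarrow>\<^sub>0 nat). \<sigma> v ^ Poly_Mapping.lookup m v))"

definition mdeg :: "('v \<Rightarrow>\<^sub>0 nat) \<Rightarrow> nat" where
  "mdeg m = (\<Sum>v\<in>Poly_Mapping.keys m. Poly_Mapping.lookup m v)"

definition homogeneous :: "'v mpoly \<Rightarrow> bool" where
  "homogeneous p \<longleftrightarrow> (\<exists>d. \<forall>m\<in>Poly_Mapping.keys p. mdeg m = d)"

text \<open>Variables: Inl j is x_(j+1), Inr j is t_(j+1) (0-based indexing of the
paper's 1-based variables).\<close>

type_synonym xtpoly = "(nat + nat) mpoly"

definition X :: "nat \<Rightarrow> xtpoly" where "X j = mvar (Inl j)"
definition T :: "nat \<Rightarrow> xtpoly" where "T j = mvar (Inr j)"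

definition Rminus :: "nat \<Rightarrow> xtpoly \<Rightarrow> xtpoly" where
  "Rminus i = msubst (\<lambda>v. case v of
      Inl j \<Rightarrow> (if j < i then X j else if j = i then T i else X (j - 1))
    | Inr j \<Rightarrow> T j)"

definition Rplus :: "nat \<Rightarrow> xtpoly \<Rightarrow> xtpoly" where
  "Rplus i = msubst (\<lambda>v. case v of
      Inl j \<Rightarrow> (if j \<le> i then X j else if j = i + 1 then T i else X (j - 1))
    | Inr j \<Rightarrow> T j)"

definition Eop :: "nat \<Rightarrow> xtpoly \<Rightarrow> xtpoly" where
  "Eop i f = (THE q. (X i - T i) * q = Rplus i f - Rminus i f)"

definition eval_x_at_t :: "xtpoly \<Rightarrow> xtpoly" where
  "eval_x_at_t = msubst (\<lambda>v. case v of Inl j \<Rightarrow> T j | Inr j \<Rightarrow> T j)"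

definition hat_t :: "nat \<Rightarrow> xtpoly \<Rightarrow> xtpoly" where
  "hat_t i = msubst (\<lambda>v. case v of
      Inl j \<Rightarrow> X j
    | Inr j \<Rightarrow> (if j < i then T j else T (j + 1)))"

definition in_Zt :: "xtpoly \<Rightarrow> bool" where
  "in_Zt p \<longleftrightarrow> (\<forall>m\<in>Poly_Mapping.keys p. \<forall>v\<in>Poly_Mapping.keys m. \<exists>j. v = Inr j)"

definition graham_positive :: "xtpoly \<Rightarrow> bool" where
  "graham_positive p \<longleftrightarrow>
     (\<exists>q :: nat mpoly. (\<forall>m. Poly_Mapping.lookup q m \<ge> 0) \<and>
        p = msubst (\<lambda>j. T (j + 1) - T j) q)"

datatype tree = Lf | Nd tree tree

text \<open>An indexed forest is a sequence F 0, F 1, ... (the paper's T_1, T_2, ...)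
of binary plane trees, all but finitely many being the one-node tree Lf.\<close>
definition is_forest :: "(nat \<Rightarrow> tree) \<Rightarrow> bool" where
  "is_forest F \<longleftrightarrow> finite {k. F k \<noteq> Lf}"

definition empty_forest :: "nat \<Rightarrow> tree" where
  "empty_forest = (\<lambda>k. Lf)"

fun nleaves :: "tree \<Rightarrow> nat" where
  "nleaves Lf = 1"
| "nleaves (Nd l r) = nleaves l + nleaves r"

text \<open>Leaves are numbered 0,1,2,... left to right (the paper's 1,2,3,...);
the leaves of tree F k start at label offset F k.\<close>
definition offset :: "(nat \<Rightarrow> tree) \<Rightarrow> nat \<Rightarrow> nat" where
  "offset F k = (\<Sum>j<k. nleaves (F j))"

text \<open>Labels rho(v) of the terminal nodes v of a tree whose leftmost leaf has
label a (rho(v) is the leftmost leaf below v).\<close>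
fun term_rhos :: "tree \<Rightarrow> nat \<Rightarrow> nat set" where
  "term_rhos Lf a = {}"
| "term_rhos (Nd Lf Lf) a = {a}"
| "term_rhos (Nd l r) a = term_rhos l a \<union> term_rhos r (a + nleaves l)"

definition Qdes :: "(nat \<Rightarrow> tree) \<Rightarrow> nat set" where
  "Qdes F = (\<Union>k. term_rhos (F k) (offset F k))"

fun contract_tree :: "tree \<Rightarrow> nat \<Rightarrow> nat \<Rightarrow> tree" where
  "contract_tree Lf a i = Lf"
| "contract_tree (Nd Lf Lf) a i = (if a = i then Lf else Nd Lf Lf)"
| "contract_tree (Nd l r) a i =
     Nd (contract_tree l a i) (contract_tree r (a + nleaves l) i)"

definition contract :: "(nat \<Rightarrow> tree) \<Rightarrow> nat \<Rightarrow> (nat \<Rightarrow> tree)" where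
  "contract F i = (\<lambda>k. contract_tree (F k) (offset F k) i)"

text \<open>The defining properties of the family (P_F); values on non-forests are
fixed to 0 so that the family is unique.\<close>
definition is_dfp_family :: "((nat \<Rightarrow> tree) \<Rightarrow> xtpoly) \<Rightarrow> bool" where
  "is_dfp_family P \<longleftrightarrow>
     (\<forall>F. \<not> is_forest F \<longrightarrow> P F = 0) \<and>
     (\<forall>F. is_forest F \<longrightarrow>
        homogeneous (P F) \<and>
        eval_x_at_t (P F) = (if F = empty_forest then 1 else 0) \<and>
        (\<forall>i. Eop i (P F) =
               (if i \<in> Qdes F then hat_t i (P (contract F i)) else 0)))"

definition DFP :: "(nat \<Rightarrow> tree) \<Rightarrow> xtpoly" where
  "DFP = (THE P. is_dfp_family P)"

end

theory Submission
  imports Defs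
begin

text \<open>
  The operators \<open>E\<^sub>i\<close> lower a forest by one node, so the coefficient of \<open>P\<^sub>H\<close> in a polynomial f is
  obtained by applying the \<open>E\<^sub>i\<close> that take H apart and then setting x = t. Call f positive if all
  its coefficients are Graham-positive. By the Leibniz rule
  \<open>E\<^sub>i (f g) = E\<^sub>i f \<cdot> R\<^sub>i\<^sup>+ g + R\<^sub>i\<^sup>- f \<cdot> E\<^sub>i g\<close> and induction on H, positive polynomials are closed
  under products as soon as they are closed under \<open>R\<^sub>i\<^sup>+\<close> and \<open>R\<^sub>i\<^sup>-\<close>. The latter follows, again by
  induction on H, from commutation relations between \<open>E\<^sub>j\<close> and \<open>R\<^sub>i\<^sup>+\<close>, \<open>R\<^sub>i\<^sup>-\<close>, whose correction terms
  carry only factors \<open>t\<^sub>k - t\<^sub>l\<close> with k > l.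
  The family \<open>P\<^sub>F\<close> exists because the relations \<open>E\<^sub>i E\<^sub>j = E\<^sub>j\<^sub>-\<^sub>1 E\<^sub>i\<close> for i < j - 1 (each operator
  with its own t-parameter) are the only obstruction to prescribing all \<open>E\<^sub>i f\<close>.
\<close>

section \<open>Substitution homomorphisms\<close>

lemma sum_single_lookup:
  fixes p :: "'a \<Rightarrow>\<^sub>0 'b::comm_monoid_add"
  shows "(\<Sum>m\<in>Poly_Mapping.keys p. Poly_Mapping.single m (Poly_Mapping.lookup p m)) = p"
  by (rule poly_mapping_eqI)
    (auto simp: lookup_sum lookup_single when_def in_keys_iff)

lemma mpoly_induct_single [case_names single add]:
  fixes p :: "'v mpoly"
  assumes single: "\<And>m c. Q (Poly_Mapping.single m c)"
    and add: "\<And>p q. Q p \<Longrightarrow> Q q \<Longrightarrow> Q (p + q)"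
  shows "Q p"
proof -
  have "Q (\<Sum>m\<in>S. Poly_Mapping.single m (Poly_Mapping.lookup p m))" if "finite S" for S
    using that
  proof induction
    case empty
    then show ?case using single[of 0 0] by simp
  qed (simp add: assms)
  from this[OF finite_keys, of p] show ?thesis by (simp only: sum_single_lookup)
qed

definition monom_subst :: "('v \<Rightarrow> 'w mpoly) \<Rightarrow> ('v \<Rightarrow>\<^sub>0 nat) \<Rightarrow> 'w mpoly" where
  "monom_subst \<sigma> m = (\<Prod>v\<in>Poly_Mapping.keys m. \<sigma> v ^ Poly_Mapping.lookup m v)"

text \<open>Variables outside the support contribute a factor 1, so monomials with different
  supports can be compared over a common index set.\<close>

lemma monom_subst_superset:
  assumes "finite S" "Poly_Mapping.keys m \<subseteq> S"
  shows "monom_subst \<sigma> m = (\<Prod>v\<in>S. \<sigma> v ^ Poly_Mapping.lookup m v)"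
  unfolding monom_subst_def
  by (rule prod.mono_neutral_left) (use assms in \<open>auto simp: in_keys_iff\<close>)

lemma monom_subst_0 [simp]: "monom_subst \<sigma> 0 = 1"
  by (simp add: monom_subst_def)

lemma monom_subst_add: "monom_subst \<sigma> (m + n) = monom_subst \<sigma> m * monom_subst \<sigma> n"
proof -
  let ?S = "Poly_Mapping.keys m \<union> Poly_Mapping.keys n"
  have "monom_subst \<sigma> k = (\<Prod>v\<in>?S. \<sigma> v ^ Poly_Mapping.lookup k v)"
    if "k \<in> {m, n, m + n}" for k
    by (rule monom_subst_superset) (use that keys_add[of m n] in auto)
  then show ?thesis by (simp add: lookup_add power_add prod.distrib)
qed

lemma mconst_0 [simp]: "mconst 0 = 0"
  and mconst_1 [simp]: "mconst 1 = 1"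
  by (simp_all add: mconst_def)

lemma mconst_add: "mconst (a + b) = mconst a + mconst b"
  by (simp add: mconst_def single_add)

lemma mconst_mult: "mconst (a * b) = mconst a * mconst b"
  by (simp add: mconst_def mult_single)

lemma msubst_superset:
  assumes "finite S" "Poly_Mapping.keys p \<subseteq> S"
  shows "msubst \<sigma> p = (\<Sum>m\<in>S. mconst (Poly_Mapping.lookup p m) * monom_subst \<sigma> m)"
  unfolding msubst_def monom_subst_def
  by (rule sum.mono_neutral_left) (use assms in \<open>auto simp: in_keys_iff\<close>)

lemma msubst_single [simp]: "msubst \<sigma> (Poly_Mapping.single m c) = mconst c * monom_subst \<sigma> m"
  by (subst msubst_superset[of "{m}"]) auto

lemma msubst_add [simp]: "msubst \<sigma> (p + q) = msubst \<sigma> p + msubst \<sigma> q"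
proof -
  let ?S = "Poly_Mapping.keys p \<union> Poly_Mapping.keys q"
  have "msubst \<sigma> k = (\<Sum>m\<in>?S. mconst (Poly_Mapping.lookup k m) * monom_subst \<sigma> m)"
    if "k \<in> {p, q, p + q}" for k
    by (rule msubst_superset) (use that keys_add[of p q] in auto)
  then show ?thesis by (simp add: lookup_add mconst_add distrib_right sum.distrib)
qed

lemma msubst_0 [simp]: "msubst \<sigma> 0 = 0"
  by (simp add: msubst_def)

lemma msubst_mult [simp]: "msubst \<sigma> (p * q) = msubst \<sigma> p * msubst \<sigma> q"
proof (induction p rule: mpoly_induct_single)
  case (single m c)
  show ?case
    by (induction q rule: mpoly_induct_single)
      (simp_all add: mult_single mconst_mult monom_subst_add algebra_simps)
qed (simp add: distrib_right)

lemma msubst_1 [simp]: "msubst \<sigma> 1 = 1"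
  using msubst_single[of \<sigma> 0 1] by simp

lemma msubst_mconst [simp]: "msubst \<sigma> (mconst c) = mconst c"
  using msubst_single[of \<sigma> 0 c] by (simp only: monom_subst_0 mult_1_right mconst_def)

lemma msubst_uminus [simp]: "msubst \<sigma> (- p) = - msubst \<sigma> p"
  using msubst_add[of \<sigma> p "- p"] by (simp add: eq_neg_iff_add_eq_0 add.commute)

lemma msubst_diff [simp]: "msubst \<sigma> (p - q) = msubst \<sigma> p - msubst \<sigma> q"
  using msubst_add[of \<sigma> p "- q"] by simp

lemma msubst_mvar [simp]: "msubst \<sigma> (mvar v) = \<sigma> v"
  by (simp add: mvar_def monom_subst_def)

lemma msubst_power [simp]: "msubst \<sigma> (p ^ n) = msubst \<sigma> p ^ n"
  by (induction n) simp_all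

lemma msubst_prod [simp]: "msubst \<sigma> (prod f S) = (\<Prod>v\<in>S. msubst \<sigma> (f v))"
  by (induction S rule: infinite_finite_induct) simp_all

lemma monom_subst_mvar: "monom_subst mvar m = Poly_Mapping.single m 1"
proof -
  have pow: "mvar v ^ n = Poly_Mapping.single (Poly_Mapping.single v n) (1::int)" for v :: 'a and n
  proof (induction n)
    case (Suc n)
    have "mvar v ^ Suc n = Poly_Mapping.single (Poly_Mapping.single v 1 + Poly_Mapping.single v n) (1::int)"
      by (simp add: Suc) (simp add: mvar_def mult_single)
    then show ?case by (simp flip: single_add)
  qed simp
  have "(\<Prod>v\<in>S. mvar v ^ Poly_Mapping.lookup m v) =
      Poly_Mapping.single (\<Sum>v\<in>S. Poly_Mapping.single v (Poly_Mapping.lookup m v)) (1::int)"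
    if "finite S" for S
    using that by induction (simp_all add: pow mult_single)
  from this[OF finite_keys, of m] show ?thesis
    by (simp only: sum_single_lookup monom_subst_def)
qed

lemma single_eq_monom_subst: "Poly_Mapping.single m c = mconst c * monom_subst mvar m"
  by (simp add: monom_subst_mvar mconst_def mult_single)

lemma mpoly_induct [case_names mconst mvar add mult]:
  fixes p :: "'v mpoly"
  assumes mconst: "\<And>c. Q (mconst c)"
    and mvar: "\<And>v. Q (mvar v)"
    and add: "\<And>p q. Q p \<Longrightarrow> Q q \<Longrightarrow> Q (p + q)"
    and mult: "\<And>p q. Q p \<Longrightarrow> Q q \<Longrightarrow> Q (p * q)"
  shows "Q p"
proof (induction p rule: mpoly_induct_single)
  case (single m c)
  have one: "Q 1" using mconst[of 1] by simp
  have "Q (mvar v ^ n)" for v n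
    by (induction n) (simp_all add: one mvar mult)
  then have "Q (\<Prod>v\<in>S. mvar v ^ Poly_Mapping.lookup m v)" for S
    by (induction S rule: infinite_finite_induct) (simp_all add: one mult)
  then show ?case
    unfolding single_eq_monom_subst monom_subst_def by (intro mult mconst)
qed (rule add)

lemma msubst_msubst: "msubst \<sigma> (msubst \<tau> p) = msubst (\<lambda>v. msubst \<sigma> (\<tau> v)) p"
  by (induction p rule: mpoly_induct) simp_all

lemma msubst_mvar_id [simp]: "msubst mvar p = p"
  by (induction p rule: mpoly_induct) simp_all

text \<open>Congruence modulo \<open>d\<close> respects sums and products, so it passes from the
  variables to all polynomials.\<close>

lemma msubst_cong_dvd:
  assumes "\<And>v. d dvd \<sigma> v - \<tau> v"
  shows "d dvd msubst \<sigma> p - msubst \<tau> p"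
proof (induction p rule: mpoly_induct)
  case (add p q)
  have "msubst \<sigma> (p + q) - msubst \<tau> (p + q) =
      (msubst \<sigma> p - msubst \<tau> p) + (msubst \<sigma> q - msubst \<tau> q)" by simp
  with add show ?case by (simp only: dvd_add)
next
  case (mult p q)
  have "msubst \<sigma> (p * q) - msubst \<tau> (p * q) =
      (msubst \<sigma> p - msubst \<tau> p) * msubst \<sigma> q + msubst \<tau> p * (msubst \<sigma> q - msubst \<tau> q)"
    by (simp add: algebra_simps)
  with mult show ?case by (simp only: dvd_add dvd_mult dvd_mult2)
qed (use assms in auto)

text \<open>Multiplication by a variable only shifts exponents, so a variable is not a zero
  divisor.\<close>

lemma lookup_mvar_mult:
  "Poly_Mapping.lookup (mvar v * p) (Poly_Mapping.single v 1 + m) = Poly_Mapping.lookup p m"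
  by (induction p rule: mpoly_induct_single)
    (simp_all add: mvar_def mult_single lookup_single distrib_left lookup_add)

lemma mvar_mult_eq_0: "mvar v * p = 0 \<Longrightarrow> p = 0"
  by (rule poly_mapping_eqI) (metis lookup_mvar_mult lookup_zero)

text \<open>The substitution sending v to v + w is invertible and turns v - w into v.\<close>

lemma mvar_diff_mult_eq_0:
  assumes "v \<noteq> w" "(mvar v - mvar w) * p = 0"
  shows "p = 0"
proof -
  define \<sigma> :: "'a \<Rightarrow> 'a mpoly" where "\<sigma> = mvar(v := mvar v + mvar w)"
  define \<tau> :: "'a \<Rightarrow> 'a mpoly" where "\<tau> = mvar(v := mvar v - mvar w)"
  have "msubst \<sigma> ((mvar v - mvar w) * p) = mvar v * msubst \<sigma> p"
    using assms(1) by (simp add: \<sigma>_def)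
  then have "mvar v * msubst \<sigma> p = 0" using assms(2) by simp
  then have "msubst \<sigma> p = 0" by (rule mvar_mult_eq_0)
  moreover have "msubst \<tau> (msubst \<sigma> p) = p"
  proof -
    have "(\<lambda>u. msubst \<tau> (\<sigma> u)) = mvar" using assms(1) by (auto simp: \<sigma>_def \<tau>_def fun_eq_iff)
    then show ?thesis by (simp add: msubst_msubst)
  qed
  ultimately show ?thesis by simp
qed

section \<open>Homogeneity\<close>

text \<open>Homogeneity of degree d is expressed as \<open>scale2 p = 2 ^ d * p\<close>; since \<open>scale2\<close> is a ring
  homomorphism, homogeneity then passes to quotients by \<open>mvar v - mvar w\<close>.\<close>

definition scale2 :: "'v mpoly \<Rightarrow> 'v mpoly" where
  "scale2 = msubst (\<lambda>v. 2 * mvar v)"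

lemma monom_subst_scale2: "monom_subst (\<lambda>v. 2 * mvar v) m = 2 ^ mdeg m * monom_subst mvar m"
  by (simp add: monom_subst_def power_mult_distrib prod.distrib mdeg_def power_sum)

lemma mconst_numeral: "mconst (numeral n) = numeral n"
  by (simp add: mconst_def)

lemma mconst_power: "mconst (c ^ n) = mconst c ^ n"
  by (induction n) (simp_all add: mconst_mult)

lemma lookup_mconst_mult: "Poly_Mapping.lookup (mconst c * p) m = c * Poly_Mapping.lookup p m"
  by (induction p rule: mpoly_induct_single)
    (simp_all add: mconst_def mult_single lookup_single distrib_left lookup_add when_def)

lemma two_power_eq_mconst: "(2 :: 'v mpoly) ^ d = mconst (2 ^ d)"
  by (simp add: mconst_power mconst_numeral)

lemma lookup_scale2:
  "Poly_Mapping.lookup (scale2 p) m = 2 ^ mdeg m * Poly_Mapping.lookup p m"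
proof (induction p rule: mpoly_induct_single)
  case (single n c)
  have "scale2 (Poly_Mapping.single n c) = mconst (2 ^ mdeg n) * Poly_Mapping.single n c"
    unfolding scale2_def msubst_single monom_subst_scale2
    by (simp add: single_eq_monom_subst two_power_eq_mconst mult_ac)
  then show ?case by (simp add: lookup_mconst_mult lookup_single when_def)
qed (simp_all add: scale2_def lookup_add distrib_left)

definition homog :: "nat \<Rightarrow> 'v mpoly \<Rightarrow> bool" where
  "homog d p \<longleftrightarrow> scale2 p = 2 ^ d * p"

text \<open>Powers of 2 are distinct, so comparing coefficients at a monomial of the support
  determines its degree.\<close>

lemma homog_imp_homogeneous:
  assumes "homog d p"
  shows "homogeneous p"
  unfolding homogeneous_def
proof (intro exI ballI)
  fix m assume m: "m \<in> Poly_Mapping.keys p"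
  have "2 ^ mdeg m * Poly_Mapping.lookup p m = 2 ^ d * Poly_Mapping.lookup p m"
    using assms unfolding homog_def by (metis lookup_scale2 two_power_eq_mconst lookup_mconst_mult)
  with m show "mdeg m = d" by (simp add: in_keys_iff)
qed

lemma homog_0 [simp]: "homog d 0"
  by (simp add: homog_def scale2_def)

lemma homog_diff: "homog d p \<Longrightarrow> homog d q \<Longrightarrow> homog d (p - q)"
  by (simp add: homog_def scale2_def right_diff_distrib)

lemma homog_add: "homog d p \<Longrightarrow> homog d q \<Longrightarrow> homog d (p + q)"
  by (simp add: homog_def scale2_def distrib_left)

lemma homog_mvar: "homog 1 (mvar v)"
  by (simp add: homog_def scale2_def)

lemma homog_mult: "homog d p \<Longrightarrow> homog e q \<Longrightarrow> homog (d + e) (p * q)"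
  by (simp add: homog_def scale2_def power_add mult_ac)

lemma homog_msubst:
  assumes "homog d p" "\<And>v. homog 1 (\<sigma> v)"
  shows "homog d (msubst \<sigma> p)"
proof -
  have "scale2 (msubst \<sigma> p) = msubst \<sigma> (scale2 p)"
    using assms(2) by (simp add: scale2_def msubst_msubst homog_def two_power_eq_mconst
      flip: mconst_numeral)
  then show ?thesis using assms(1) by (simp add: homog_def two_power_eq_mconst)
qed

lemma homog_mvar_diff_cancel:
  assumes "v \<noteq> w" "homog (Suc d) ((mvar v - mvar w) * p)"
  shows "homog d p"
proof -
  \<comment> \<open>The linear factor absorbs one 2 of \<open>2 ^ Suc d\<close>; the remaining 2 is
    cancelled coefficientwise over the integers.\<close>
  have "2 * ((mvar v - mvar w) * (scale2 p - 2 ^ d * p)) = 0"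
    using assms(2) by (simp add: homog_def scale2_def algebra_simps)
  then have "mconst 2 * ((mvar v - mvar w) * (scale2 p - 2 ^ d * p)) = 0"
    by (simp only: mconst_numeral)
  then have "2 * Poly_Mapping.lookup ((mvar v - mvar w) * (scale2 p - 2 ^ d * p)) m = 0" for m
    by (simp only: lookup_zero flip: lookup_mconst_mult)
  then have "(mvar v - mvar w) * (scale2 p - 2 ^ d * p) = 0"
    by (intro poly_mapping_eqI) simp
  from mvar_diff_mult_eq_0[OF assms(1) this] show ?thesis by (simp add: homog_def)
qed

section \<open>Insertion operators and divided differences\<close>

definition xsub :: "(nat \<Rightarrow> xtpoly) \<Rightarrow> xtpoly \<Rightarrow> xtpoly" where
  "xsub u = msubst (case_sum u T)"

lemma xsub_simps [simp]:
  "xsub u 0 = 0" "xsub u 1 = 1" "xsub u (T j) = T j" "xsub u (X j) = u j"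
  "xsub u (mconst c) = mconst c"
  "xsub u (p + q) = xsub u p + xsub u q" "xsub u (p - q) = xsub u p - xsub u q"
  "xsub u (p * q) = xsub u p * xsub u q" "xsub u (- p) = - xsub u p"
  by (simp_all add: xsub_def X_def T_def)

lemma xsub_xsub: "xsub u (xsub w f) = xsub (\<lambda>j. xsub u (w j)) f"
  unfolding xsub_def msubst_msubst
  by (rule arg_cong[where f = "\<lambda>\<sigma>. msubst \<sigma> f"]) (auto simp: fun_eq_iff T_def split: sum.splits)

lemma xsub_X [simp]: "xsub X f = f"
proof -
  have "case_sum X T = mvar" by (auto simp: fun_eq_iff X_def T_def split: sum.splits)
  then show ?thesis by (simp add: xsub_def)
qed

text \<open>Common form of R_i^- (\<open>ins i i\<close>) and R_i^+ (\<open>ins (Suc i) i\<close>).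
  Slot and parameter are independent because parameter sequences of contracted forests skip
  indices.\<close>

definition ins :: "nat \<Rightarrow> nat \<Rightarrow> xtpoly \<Rightarrow> xtpoly" where
  "ins i k = xsub (\<lambda>j. if j < i then X j else if j = i then T k else X (j - 1))"

lemma ins_simps [simp]:
  "ins i k 0 = 0" "ins i k 1 = 1" "ins i k (T j) = T j" "ins i k (mconst c) = mconst c"
  "ins i k (p + q) = ins i k p + ins i k q" "ins i k (p - q) = ins i k p - ins i k q"
  "ins i k (p * q) = ins i k p * ins i k q" "ins i k (- p) = - ins i k p"
  by (simp_all add: ins_def)

lemma ins_X: "ins i k (X j) = (if j < i then X j else if j = i then T k else X (j - 1))"
  by (simp add: ins_def)

text \<open>Both sides fill slot \<open>j\<close> of f with \<open>T l\<close> and slot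
  \<open>Suc i\<close> with \<open>T k\<close>; filling the earlier slot pushes the later one up by
  one.\<close>

lemma ins_commute:
  assumes "j \<le> i"
  shows "ins i k (ins j l f) = ins j l (ins (Suc i) k f)"
  unfolding ins_def xsub_xsub
  by (rule arg_cong[where f = "\<lambda>\<sigma>. xsub \<sigma> f"]) (use assms in \<open>auto simp: fun_eq_iff\<close>)

lemma Rminus_eq_ins: "Rminus i = ins i i"
  unfolding Rminus_def ins_def xsub_def
  by (rule arg_cong[where f = msubst]) (auto simp: fun_eq_iff split: sum.splits)

lemma Rplus_eq_ins: "Rplus i = ins (Suc i) i"
  unfolding Rplus_def ins_def xsub_def
  by (rule arg_cong[where f = msubst]) (auto simp: fun_eq_iff split: sum.splits)

lemma X_diff_T_mult_eq_0: "(X i - T k) * p = 0 \<Longrightarrow> p = 0"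
  unfolding X_def T_def by (rule mvar_diff_mult_eq_0[OF Inl_not_Inr])

lemma X_diff_T_cancel: "(X i - T k) * p = (X i - T k) * q \<Longrightarrow> p = q"
  using X_diff_T_mult_eq_0[of i k "p - q"] by (simp add: right_diff_distrib)

text \<open>The two substitutions differ only in slots \<open>i\<close> and \<open>Suc i\<close>,
  where \<open>X i\<close> and \<open>T k\<close> are interchanged.\<close>

lemma X_diff_T_dvd: "X i - T k dvd ins (Suc i) k f - ins i k f"
  unfolding ins_def xsub_def
proof (rule msubst_cong_dvd)
  have *: "X i - T k dvd T k - X i" by (metis dvd_minus_iff dvd_refl minus_diff_eq)
  fix v :: "nat + nat"
  show "X i - T k dvd
       case_sum (\<lambda>j. if j < Suc i then X j else if j = Suc i then T k else X (j - 1)) T v -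
       case_sum (\<lambda>j. if j < i then X j else if j = i then T k else X (j - 1)) T v"
    by (cases v) (auto simp: *)
qed

text \<open>The operator E_i with an arbitrary parameter t_k in place of t_i.\<close>

definition qdd :: "nat \<Rightarrow> nat \<Rightarrow> xtpoly \<Rightarrow> xtpoly" where
  "qdd i k f = (THE q. (X i - T k) * q = ins (Suc i) k f - ins i k f)"

lemma qdd_unique:
  assumes "(X i - T k) * q = ins (Suc i) k f - ins i k f"
  shows "qdd i k f = q"
  unfolding qdd_def
proof (rule the_equality)
  show "(X i - T k) * q = ins (Suc i) k f - ins i k f" by (fact assms)
  show "p = q" if "(X i - T k) * p = ins (Suc i) k f - ins i k f" for p
    by (rule X_diff_T_cancel[of i k]) (simp only: that assms)
qed

lemma qdd_eq: "(X i - T k) * qdd i k f = ins (Suc i) k f - ins i k f"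
  using X_diff_T_dvd[of i k f] qdd_unique[of i k _ f] by (metis dvdE)

lemma Eop_eq_qdd: "Eop i f = qdd i i f"
  by (simp add: Eop_def qdd_def Rplus_eq_ins Rminus_eq_ins)

lemma qdd_add: "qdd i k (f + g) = qdd i k f + qdd i k g"
  by (rule qdd_unique) (simp add: distrib_left qdd_eq)

lemma qdd_diff: "qdd i k (f - g) = qdd i k f - qdd i k g"
  by (rule qdd_unique) (simp add: right_diff_distrib qdd_eq)

lemma qdd_eq_0: "ins (Suc i) k f = ins i k f \<Longrightarrow> qdd i k f = 0"
  by (rule qdd_unique) simp

lemma qdd_0 [simp]: "qdd i k 0 = 0"
  by (rule qdd_eq_0) simp

lemma qdd_scale:
  assumes "ins i k c = d" "ins (Suc i) k c = d"
  shows "qdd i k (c * f) = d * qdd i k f"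
proof (rule qdd_unique)
  have "(X i - T k) * (d * qdd i k f) = d * ((X i - T k) * qdd i k f)" by (simp add: mult_ac)
  then show "(X i - T k) * (d * qdd i k f) = ins (Suc i) k (c * f) - ins i k (c * f)"
    by (simp add: qdd_eq assms right_diff_distrib)
qed

text \<open>Subtract and add the mixed term \<open>ins i k f * ins (Suc i) k g\<close> in the
  difference of the two products.\<close>

lemma qdd_mult: "qdd i k (f * g) = qdd i k f * ins (Suc i) k g + ins i k f * qdd i k g"
proof (rule qdd_unique)
  have "(X i - T k) * (qdd i k f * ins (Suc i) k g + ins i k f * qdd i k g) =
      ((X i - T k) * qdd i k f) * ins (Suc i) k g + ins i k f * ((X i - T k) * qdd i k g)"
    by (simp only: distrib_left mult_ac)
  then show "(X i - T k) * (qdd i k f * ins (Suc i) k g + ins i k f * qdd i k g) =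
      ins (Suc i) k (f * g) - ins i k (f * g)"
    unfolding qdd_eq by (simp add: algebra_simps)
qed

section \<open>Commutation of divided differences with insertions\<close>

lemma qdd_ins_below:
  assumes "Suc j \<le> i"
  shows "qdd j l (ins (Suc i) k f) = ins i k (qdd j l f)"
proof (rule qdd_unique)
  have "(X j - T l) * ins i k (qdd j l f) = ins i k ((X j - T l) * qdd j l f)"
    using assms by (simp add: ins_X)
  also have "\<dots> = ins i k (ins (Suc j) l f) - ins i k (ins j l f)"
    by (simp add: qdd_eq)
  finally show "(X j - T l) * ins i k (qdd j l f) =
      ins (Suc j) l (ins (Suc i) k f) - ins j l (ins (Suc i) k f)"
    using assms by (simp add: ins_commute)
qed

text \<open>Since slot \<open>i\<close> of f is filled, the variable \<open>X j\<close> of the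
  result stands in slot \<open>Suc j\<close> of f; hence the shifted operator.\<close>

lemma qdd_ins_above:
  assumes "i \<le> j"
  shows "qdd j l (ins i k f) = ins i k (qdd (Suc j) l f)"
proof (rule qdd_unique)
  have "(X j - T l) * ins i k (qdd (Suc j) l f) = ins i k ((X (Suc j) - T l) * qdd (Suc j) l f)"
    using assms by (simp add: ins_X)
  also have "\<dots> = ins i k (ins (Suc (Suc j)) l f) - ins i k (ins (Suc j) l f)"
    by (simp add: qdd_eq)
  finally show "(X j - T l) * ins i k (qdd (Suc j) l f) =
      ins (Suc j) l (ins i k f) - ins j l (ins i k f)"
    using assms by (simp add: ins_commute)
qed

text \<open>The remaining commutation of a divided difference with an insertion, in two forms: in the
  first the correction term is positive if l < k, in the second if k < l.\<close>

lemma qdd_ins_middle_gt: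
  "qdd m l (ins (Suc m) k f) =
    ins (Suc m) k (qdd m l f) + ins m l (qdd (Suc m) k f) +
    (T k - T l) * qdd m l (qdd (Suc m) k f)"
proof (rule qdd_unique)
  let ?h = "qdd (Suc m) k f"
  have 1: "(X m - T l) * ins (Suc m) k (qdd m l f) =
      ins (Suc m) k (ins (Suc m) l f) - ins (Suc m) k (ins m l f)"
    using arg_cong[OF qdd_eq[of m l f], of "ins (Suc m) k"] by (simp add: ins_X)
  \<comment> \<open>Slot \<open>Suc m\<close> receives \<open>T l\<close>, so
    \<open>X (Suc m) - T k\<close> becomes a difference of parameters: the source of the correction
    term.\<close>
  have 2: "(T l - T k) * ins (Suc m) l ?h =
      ins (Suc m) l (ins (Suc (Suc m)) k f) - ins (Suc m) l (ins (Suc m) k f)"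
    using arg_cong[OF qdd_eq[of "Suc m" k f], of "ins (Suc m) l"] by (simp add: ins_X)
  have 3: "(X m - T k) * ins m l ?h =
      ins m l (ins (Suc (Suc m)) k f) - ins m l (ins (Suc m) k f)"
    using arg_cong[OF qdd_eq[of "Suc m" k f], of "ins m l"] by (simp add: ins_X)
  have "(X m - T l) * (ins (Suc m) k (qdd m l f) + ins m l ?h + (T k - T l) * qdd m l ?h) =
      (X m - T l) * ins (Suc m) k (qdd m l f) + (X m - T l) * ins m l ?h +
      (T k - T l) * ((X m - T l) * qdd m l ?h)"
    by (simp add: algebra_simps)
  also have "\<dots> = (X m - T l) * ins (Suc m) k (qdd m l f) + (X m - T k) * ins m l ?h -
      (T l - T k) * ins (Suc m) l ?h"
    unfolding qdd_eq by (simp add: algebra_simps)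
  also have "\<dots> = ins (Suc m) l (ins (Suc m) k f) - ins m l (ins (Suc m) k f)"
    unfolding 1 2 3 by (simp add: ins_commute)
  finally show "(X m - T l) * (ins (Suc m) k (qdd m l f) + ins m l ?h + (T k - T l) * qdd m l ?h) =
    ins (Suc m) l (ins (Suc m) k f) - ins m l (ins (Suc m) k f)" .
qed

lemma qdd_ins_middle_less:
  "qdd m l (ins (Suc m) k f) =
    ins (Suc m) l (qdd m k f) + ins m k (qdd (Suc m) l f) +
    (T l - T k) * qdd m l (qdd m k f)"
proof (rule qdd_unique)
  let ?h = "qdd m k f"
  have 1: "(X m - T l) * ins m k (qdd (Suc m) l f) =
      ins m k (ins (Suc (Suc m)) l f) - ins m k (ins (Suc m) l f)"
    using arg_cong[OF qdd_eq[of "Suc m" l f], of "ins m k"] by (simp add: ins_X)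
  have 2: "(T l - T k) * ins m l ?h = ins m l (ins (Suc m) k f) - ins m l (ins m k f)"
    using arg_cong[OF qdd_eq[of m k f], of "ins m l"] by (simp add: ins_X)
  have 3: "(X m - T k) * ins (Suc m) l ?h =
      ins (Suc m) l (ins (Suc m) k f) - ins (Suc m) l (ins m k f)"
    using arg_cong[OF qdd_eq[of m k f], of "ins (Suc m) l"] by (simp add: ins_X)
  have "(X m - T l) * (ins (Suc m) l ?h + ins m k (qdd (Suc m) l f) + (T l - T k) * qdd m l ?h) =
      (X m - T l) * ins (Suc m) l ?h + (X m - T l) * ins m k (qdd (Suc m) l f) +
      (T l - T k) * ((X m - T l) * qdd m l ?h)"
    by (simp add: algebra_simps)
  also have "\<dots> = (X m - T k) * ins (Suc m) l ?h + (X m - T l) * ins m k (qdd (Suc m) l f) -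
      (T l - T k) * ins m l ?h"
    unfolding qdd_eq by (simp add: algebra_simps)
  also have "\<dots> = ins (Suc m) l (ins (Suc m) k f) - ins m l (ins (Suc m) k f)"
    unfolding 1 2 3 by (simp add: ins_commute)
  finally show "(X m - T l) * (ins (Suc m) l ?h + ins m k (qdd (Suc m) l f) + (T l - T k) * qdd m l ?h) =
    ins (Suc m) l (ins (Suc m) k f) - ins m l (ins (Suc m) k f)" .
qed

text \<open>For \<open>i < j\<close> the factor \<open>X i - T k\<close> is fixed by insertions at
  \<open>j\<close> and \<open>Suc j\<close>, so it is a scalar for \<open>qdd j l\<close>.\<close>

lemma qdd_commute:
  assumes "i < j"
  shows "qdd i k (qdd (Suc j) l f) = qdd j l (qdd i k f)"
proof (rule qdd_unique)
  have "(X i - T k) * qdd j l (qdd i k f) = qdd j l ((X i - T k) * qdd i k f)"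
    by (rule qdd_scale[symmetric]) (use assms in \<open>simp_all add: ins_X\<close>)
  also have "\<dots> = qdd j l (ins (Suc i) k f) - qdd j l (ins i k f)"
    by (simp add: qdd_eq qdd_diff)
  finally show "(X i - T k) * qdd j l (qdd i k f) =
      ins (Suc i) k (qdd (Suc j) l f) - ins i k (qdd (Suc j) l f)"
    using assms by (simp add: qdd_ins_above)
qed

lemma homog_X_diff_T: "homog 1 (X i - T k)"
  unfolding X_def T_def by (intro homog_diff homog_mvar)

lemma homog_xsub:
  assumes "homog d f" "\<And>j. homog 1 (u j)"
  shows "homog d (xsub u f)"
  unfolding xsub_def
proof (rule homog_msubst)
  show "homog 1 (case_sum u T v)" for v
    using assms(2) by (cases v) (auto simp: T_def homog_mvar[simplified])
qed (fact assms(1))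

lemma homog_qdd:
  assumes "homog (Suc d) f"
  shows "homog d (qdd i k f)"
proof -
  have "homog (Suc d) (ins j k f)" for j
    unfolding ins_def
    by (rule homog_xsub[OF assms]) (auto simp: X_def T_def homog_mvar[simplified])
  then have "homog (Suc d) ((X i - T k) * qdd i k f)"
    by (simp add: qdd_eq homog_diff)
  then show ?thesis
    unfolding X_def T_def by (rule homog_mvar_diff_cancel[rotated]) simp
qed

section \<open>Polynomials in the first N of the x-variables\<close>

text \<open>Stated through substitutions rather than the support, so that closure under products and
  behaviour under insertions are immediate.\<close>

definition xbound :: "nat \<Rightarrow> xtpoly \<Rightarrow> bool" where
  "xbound N f \<longleftrightarrow> (\<forall>u w. (\<forall>j<N. u j = w j) \<longrightarrow> xsub u f = xsub w f)"

lemma xboundD: "xbound N f \<Longrightarrow> (\<And>j. j < N \<Longrightarrow> u j = w j) \<Longrightarrow> xsub u f = xsub w f"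
  by (simp add: xbound_def)

lemma xbound_mono: "xbound N f \<Longrightarrow> N \<le> M \<Longrightarrow> xbound M f"
  by (auto simp: xbound_def)

lemma xbound_mult: "xbound N f \<Longrightarrow> xbound N g \<Longrightarrow> xbound N (f * g)"
  unfolding xbound_def xsub_simps by metis

lemma xbound_X_diff_T: "i < N \<Longrightarrow> xbound N (X i - T k)"
  by (auto simp: xbound_def)

lemma xbound_exists: "\<exists>N. xbound N f"
proof (induction f rule: mpoly_induct)
  case (mvar v)
  show ?case
  proof (cases v)
    case (Inl j)
    then have "xbound (Suc j) (mvar v)" by (auto simp: xbound_def simp flip: X_def)
    then show ?thesis ..
  next
    case (Inr j)
    then have "xbound 0 (mvar v)" by (auto simp: xbound_def simp flip: T_def)
    then show ?thesis ..
  qed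
next
  case (add p q)
  then obtain M N where "xbound M p" "xbound N q" by blast
  then have "xbound (max M N) p" "xbound (max M N) q" by (auto intro: xbound_mono)
  then have "xbound (max M N) (p + q)" unfolding xbound_def xsub_simps by metis
  then show ?case ..
next
  case (mult p q)
  then obtain M N where "xbound M p" "xbound N q" by blast
  then have "xbound (max M N) p" "xbound (max M N) q" by (auto intro: xbound_mono)
  then show ?case using xbound_mult by blast
qed (auto simp: xbound_def)

lemma ins_xbound: "xbound N f \<Longrightarrow> N \<le> i \<Longrightarrow> ins i k f = f"
  unfolding ins_def using xboundD[of N f _ X] by simp

lemma qdd_xbound: "xbound N f \<Longrightarrow> N \<le> i \<Longrightarrow> qdd i k f = 0"
  by (rule qdd_eq_0) (simp add: ins_xbound)

text \<open>If x_N is the last variable that may occur, insertion at \<open>Suc N\<close> fixes g; a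
  vanishing divided difference then gives g = \<open>ins N (s N) g\<close>, in which x_N is replaced
  by a parameter.\<close>

lemma xbound_descend:
  assumes "xbound (M + n) g" "\<And>k. M \<le> k \<Longrightarrow> qdd k (s k) g = 0"
  shows "xbound M g"
  using assms(1)
proof (induction n)
  case (Suc n)
  let ?N = "M + n"
  have "ins (Suc ?N) (s ?N) g = ins ?N (s ?N) g"
    using qdd_eq[of ?N "s ?N" g] assms(2)[of ?N] by simp
  then have g: "g = ins ?N (s ?N) g" using Suc.prems by (simp add: ins_xbound)
  have "xbound ?N (ins ?N (s ?N) g)"
    unfolding xbound_def
  proof (intro allI impI)
    fix u w :: "nat \<Rightarrow> xtpoly" assume "\<forall>j<?N. u j = w j"
    then show "xsub u (ins ?N (s ?N) g) = xsub w (ins ?N (s ?N) g)"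
      unfolding ins_def xsub_xsub by (intro xboundD[OF Suc.prems]) auto
  qed
  then show ?case using g Suc.IH by simp
qed simp

lemma xbound_if_qdd_eq_0:
  assumes "\<And>k. M \<le> k \<Longrightarrow> qdd k (s k) g = 0"
  shows "xbound M g"
proof -
  obtain N where "xbound N g" using xbound_exists by blast
  then have "xbound (M + N) g" by (auto intro: xbound_mono)
  then show ?thesis using xbound_descend assms by blast
qed

section \<open>Evaluation of the x-variables at a parameter sequence\<close>

definition tev :: "(nat \<Rightarrow> nat) \<Rightarrow> xtpoly \<Rightarrow> xtpoly" where
  "tev s = xsub (\<lambda>j. T (s j))"

lemma tev_simps [simp]:
  "tev s 0 = 0" "tev s 1 = 1" "tev s (T j) = T j" "tev s (X j) = T (s j)"
  "tev s (mconst c) = mconst c"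
  "tev s (p + q) = tev s p + tev s q" "tev s (p - q) = tev s p - tev s q"
  "tev s (p * q) = tev s p * tev s q" "tev s (- p) = - tev s p"
  by (simp_all add: tev_def)

lemma xsub_tev [simp]: "xsub u (tev s f) = tev s f"
  by (simp add: tev_def xsub_xsub)

text \<open>Vanishing divided differences leave no x-variable, so f equals its evaluation at the
  parameters.\<close>

lemma eq_0_if_qdd_eq_0:
  assumes "\<And>i. qdd i (s i) f = 0" "tev s f = 0"
  shows "f = 0"
proof -
  have "xbound 0 f" using assms(1) by (rule xbound_if_qdd_eq_0)
  then have "xsub X f = tev s f" unfolding tev_def by (rule xboundD) simp
  then show ?thesis using assms(2) by simp
qed

lemma eq_if_qdd_eq:
  assumes "\<And>i. qdd i (s i) f = qdd i (s i) g" "tev s f = tev s g"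
  shows "f = g"
  using eq_0_if_qdd_eq_0[of s "f - g"] assms by (simp add: qdd_diff)

text \<open>The relations of \<open>qdd_commute\<close> are the only obstruction to prescribing all divided differences
  of a polynomial: if n is the last index with \<open>g n \<noteq> 0\<close>, then subtracting the contribution of
  \<open>(X n - T n) * g n\<close> makes \<open>g n\<close> vanish.\<close>

lemma qdd_integrate:
  assumes "\<And>i j. i < j \<Longrightarrow> qdd i i (g (Suc j)) = qdd j (Suc j) (g i)"
    and "\<And>i. n \<le> i \<Longrightarrow> g i = 0"
    and "\<And>i. homog d (g i)"
  shows "\<exists>f. homog (Suc d) f \<and> (\<forall>i. qdd i i f = g i)"
  using assms
proof (induction n arbitrary: g)
  case 0
  have "homog (Suc d) 0 \<and> (\<forall>i. qdd i i 0 = g i)" using 0 by simp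
  then show ?case ..
next
  case (Suc n)
  let ?f = "(X n - T n) * g n"
  have hom: "homog (Suc d) ?f"
    using homog_mult[OF homog_X_diff_T Suc.prems(3), of n n n] by simp
  \<comment> \<open>Compatibility with \<open>g (Suc k) = 0\<close> kills the divided differences of
    \<open>g n\<close> beyond n, taken along the parameters \<open>Suc k\<close>; so
    \<open>g n\<close> involves only the first n + 1 variables.\<close>
  have "qdd k (Suc k) (g n) = 0" if "Suc n \<le> k" for k
    using Suc.prems(1)[of n k] Suc.prems(2)[of "Suc k"] that by simp
  then have bound: "xbound (Suc n) (g n)" by (rule xbound_if_qdd_eq_0)
  then have fbound: "xbound (Suc n) ?f" by (intro xbound_mult xbound_X_diff_T) simp
  \<comment> \<open>Insertion in slot n kills the factor \<open>X n - T n\<close>, and insertion in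
    slot \<open>Suc n\<close> fixes the whole product.\<close>
  have fn: "qdd n n ?f = g n"
    by (rule qdd_unique) (simp add: ins_X ins_xbound[OF bound])
  define g' where "g' i = g i - qdd i i ?f" for i
  have "\<exists>f. homog (Suc d) f \<and> (\<forall>i. qdd i i f = g' i)"
  proof (rule Suc.IH)
    show "qdd i i (g' (Suc j)) = qdd j (Suc j) (g' i)" if "i < j" for i j
      using Suc.prems(1)[OF that] by (simp only: g'_def qdd_diff qdd_commute[OF that])
    show "g' i = 0" if "n \<le> i" for i
    proof (cases "i = n")
      case False
      with that show ?thesis
        using Suc.prems(2)[of i] qdd_xbound[OF fbound, of i i] by (simp add: g'_def)
    qed (simp add: g'_def fn)
    show "homog d (g' i)" for i
      unfolding g'_def by (intro homog_diff Suc.prems(3) homog_qdd hom)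
  qed
  then obtain f where f: "homog (Suc d) f" "\<And>i. qdd i i f = g' i" by blast
  then have "homog (Suc d) (f + ?f) \<and> (\<forall>i. qdd i i (f + ?f) = g i)"
    using hom by (simp add: homog_add qdd_add g'_def)
  then show ?case ..
qed

section \<open>Reindexing the t-variables\<close>

text \<open>A map s on indices stands for the parameter sequence \<open>T (s 0), T (s 1), \<dots>\<close>. Removing its entry i,
  as \<open>hat_t\<close> does, is the step from s to \<open>s \<circ> skip i\<close>.\<close>

definition tsub :: "(nat \<Rightarrow> nat) \<Rightarrow> xtpoly \<Rightarrow> xtpoly" where
  "tsub s = msubst (case_sum X (\<lambda>j. T (s j)))"

lemma tsub_simps [simp]:
  "tsub s 0 = 0" "tsub s 1 = 1" "tsub s (T j) = T (s j)" "tsub s (X j) = X j"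
  "tsub s (p + q) = tsub s p + tsub s q" "tsub s (p - q) = tsub s p - tsub s q"
  "tsub s (p * q) = tsub s p * tsub s q"
  by (simp_all add: tsub_def X_def T_def)

lemma tsub_tsub: "tsub r (tsub s f) = tsub (r \<circ> s) f"
  unfolding tsub_def msubst_msubst
  by (rule arg_cong[where f = "\<lambda>\<sigma>. msubst \<sigma> f"])
    (auto simp: fun_eq_iff T_def X_def split: sum.splits)

lemma tsub_id [simp]: "tsub id f = f"
proof -
  have "case_sum X (\<lambda>j. T (id j)) = mvar" by (auto simp: fun_eq_iff X_def T_def split: sum.splits)
  then show ?thesis by (simp add: tsub_def)
qed

lemma tsub_ins: "tsub s (ins i k f) = ins i (s k) (tsub s f)"
  unfolding tsub_def ins_def xsub_def msubst_msubst
  by (rule arg_cong[where f = "\<lambda>\<sigma>. msubst \<sigma> f"])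
    (auto simp: fun_eq_iff T_def X_def split: sum.splits)

lemma tsub_tev: "tsub s (tev r f) = tev (s \<circ> r) (tsub s f)"
  unfolding tsub_def tev_def xsub_def msubst_msubst
  by (rule arg_cong[where f = "\<lambda>\<sigma>. msubst \<sigma> f"])
    (auto simp: fun_eq_iff T_def X_def split: sum.splits)

lemma qdd_tsub: "qdd i (s k) (tsub s f) = tsub s (qdd i k f)"
  by (rule qdd_unique)
    (use arg_cong[OF qdd_eq[of i k f], of "tsub s"] in \<open>simp add: tsub_ins\<close>)

lemma homog_tsub: "homog d f \<Longrightarrow> homog d (tsub s f)"
  unfolding tsub_def
  by (erule homog_msubst) (auto simp: X_def T_def homog_mvar[simplified] split: sum.splits)

definition skip :: "nat \<Rightarrow> nat \<Rightarrow> nat" where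
  "skip i j = (if j < i then j else Suc j)"

text \<open>Both sides enumerate the indices other than \<open>i\<close> and \<open>Suc j\<close> in
  increasing order.\<close>

lemma skip_comp_skip: "i \<le> j \<Longrightarrow> skip i \<circ> skip j = skip (Suc j) \<circ> skip i"
  by (auto simp: skip_def fun_eq_iff)

lemma strict_mono_comp_skip: "strict_mono s \<Longrightarrow> strict_mono (s \<circ> skip i)"
  by (auto simp: strict_mono_def skip_def)

lemma hat_t_eq_tsub: "hat_t i = tsub (skip i)"
  unfolding hat_t_def tsub_def skip_def
  by (rule arg_cong[where f = msubst]) (auto simp: fun_eq_iff split: sum.splits)

lemma eval_x_at_t_eq_tev: "eval_x_at_t = tev id"
  unfolding eval_x_at_t_def tev_def xsub_def
  by (rule arg_cong[where f = msubst]) (auto simp: fun_eq_iff split: sum.splits)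

section \<open>Growing and contracting forests\<close>

text \<open>One conditional equation replaces the overlapping patterns, so tree inductions need no
  further case split on the children.\<close>

lemma term_rhos_Nd:
  "term_rhos (Nd l r) a =
    (if l = Lf \<and> r = Lf then {a} else term_rhos l a \<union> term_rhos r (a + nleaves l))"
  by (cases l; cases r) auto

lemma contract_tree_Nd:
  "contract_tree (Nd l r) a i =
    (if l = Lf \<and> r = Lf then if a = i then Lf else Nd Lf Lf
     else Nd (contract_tree l a i) (contract_tree r (a + nleaves l) i))"
  by (cases l; cases r) auto

lemmas [simp del] = term_rhos.simps(2,3) contract_tree.simps(2,3)
lemmas [simp] = term_rhos_Nd contract_tree_Nd

text \<open>Inverse of contraction. It turns statements about terminal nodes into equations
  \<open>F = grow K i\<close>.\<close>

fun grow_tree :: "tree \<Rightarrow> nat \<Rightarrow> nat \<Rightarrow> tree" where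
  "grow_tree Lf a i = (if a = i then Nd Lf Lf else Lf)"
| "grow_tree (Nd l r) a i = Nd (grow_tree l a i) (grow_tree r (a + nleaves l) i)"

definition grow :: "(nat \<Rightarrow> tree) \<Rightarrow> nat \<Rightarrow> nat \<Rightarrow> tree" where
  "grow F i = (\<lambda>k. grow_tree (F k) (offset F k) i)"

lemma nleaves_pos [simp]: "0 < nleaves t"
  by (induction t) auto

lemma term_rhos_bounds: "i \<in> term_rhos t a \<Longrightarrow> a \<le> i \<and> Suc i < a + nleaves t"
proof (induction t arbitrary: a)
  case (Nd l r)
  then show ?case
    using Nd.IH(1)[of a] Nd.IH(2)[of "a + nleaves l"] nleaves_pos[of r]
    by (fastforce split: if_splits simp del: nleaves_pos)
qed simp

lemma contract_tree_idle: "i \<notin> term_rhos t a \<Longrightarrow> contract_tree t a i = t"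
  by (induction t arbitrary: a) (auto split: if_splits)

lemma contract_tree_outside: "i < a \<or> a + nleaves t \<le> i \<Longrightarrow> contract_tree t a i = t"
  by (rule contract_tree_idle) (use term_rhos_bounds in fastforce)

lemma grow_tree_outside: "i < a \<or> a + nleaves t \<le> i \<Longrightarrow> grow_tree t a i = t"
  by (induction t arbitrary: a) auto

lemma nleaves_grow_tree:
  "nleaves (grow_tree t a i) = nleaves t + of_bool (a \<le> i \<and> i < a + nleaves t)"
proof (induction t arbitrary: a)
  case (Nd l r)
  show ?case using nleaves_pos[of l] by (auto simp: Nd simp del: nleaves_pos)
qed auto

lemma nleaves_contract_tree: "i \<in> term_rhos t a \<Longrightarrow> Suc (nleaves (contract_tree t a i)) = nleaves t"
proof (induction t arbitrary: a)
  case (Nd l r)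
  show ?case
  proof (cases "l = Lf \<and> r = Lf")
    case False
    with Nd.prems consider "i \<in> term_rhos l a" | "i \<in> term_rhos r (a + nleaves l)" by auto
    then show ?thesis
    proof cases
      case 1
      then show ?thesis
        using False Nd.IH(1)[OF 1] term_rhos_bounds[OF 1] by (auto simp: contract_tree_outside)
    next
      case 2
      then show ?thesis
        using False Nd.IH(2)[OF 2] term_rhos_bounds[OF 2] by (auto simp: contract_tree_outside)
    qed
  qed (use Nd.prems in auto)
qed simp

lemma grow_contract_tree: "i \<in> term_rhos t a \<Longrightarrow> grow_tree (contract_tree t a i) a i = t"
proof (induction t arbitrary: a)
  case (Nd l r)
  show ?case
  proof (cases "l = Lf \<and> r = Lf")
    case False
    with Nd.prems consider "i \<in> term_rhos l a" | "i \<in> term_rhos r (a + nleaves l)" by auto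
    then show ?thesis
    proof cases
      case 1
      then show ?thesis
        \<comment> \<open>After contraction the right subtree starts one label earlier; the strict
          bound on \<open>Suc i\<close> still keeps \<open>i\<close> to its left.\<close>
        using False Nd.IH(1)[OF 1] term_rhos_bounds[OF 1] nleaves_contract_tree[OF 1]
        by (auto simp: contract_tree_outside grow_tree_outside)
    next
      case 2
      then show ?thesis
        using False Nd.IH(2)[OF 2] term_rhos_bounds[OF 2]
        by (auto simp: contract_tree_outside grow_tree_outside)
    qed
  qed (use Nd.prems in auto)
qed simp

lemma contract_grow_tree:
  assumes "a \<le> i" "i < a + nleaves t"
  shows "contract_tree (grow_tree t a i) a i = t" "i \<in> term_rhos (grow_tree t a i) a"
proof -
  have "contract_tree (grow_tree t a i) a i = t \<and> i \<in> term_rhos (grow_tree t a i) a"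
    using assms
  proof (induction t arbitrary: a)
    case (Nd l r)
    show ?case
    proof (cases "i < a + nleaves l")
      case True
      with Nd.IH(1)[of a] Nd.prems have
        "contract_tree (grow_tree l a i) a i = l \<and> i \<in> term_rhos (grow_tree l a i) a" by simp
      then show ?thesis
        using True by (auto simp: contract_tree_outside grow_tree_outside nleaves_grow_tree)
    next
      case False
      with Nd.IH(2)[of "a + nleaves l"] Nd.prems have
        "contract_tree (grow_tree r (a + nleaves l) i) (a + nleaves l) i = r \<and>
         i \<in> term_rhos (grow_tree r (a + nleaves l) i) (a + nleaves l)" by simp
      then show ?thesis
        using False by (auto simp: contract_tree_outside grow_tree_outside)
    qed
  qed auto
  then show "contract_tree (grow_tree t a i) a i = t" "i \<in> term_rhos (grow_tree t a i) a"
    by auto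
qed

text \<open>Growing leaf i moves the first leaf a of a tree to \<open>a + of_bool (i < a)\<close>.\<close>

lemma grow_tree_commute:
  assumes "i < j"
  shows "grow_tree (grow_tree t a i) (a + of_bool (i < a)) (Suc j) =
    grow_tree (grow_tree t a j) (a + of_bool (j < a)) i"
proof (induction t arbitrary: a)
  case (Nd l r)
  \<comment> \<open>The first label of the right subtree moves by the same rule as \<open>a\<close>,
    so the induction hypothesis applies to it.\<close>
  have shift: "a + of_bool (h < a) + nleaves (grow_tree l a h) =
      a + nleaves l + of_bool (h < a + nleaves l)" for h
    using nleaves_pos[of l] by (auto simp: nleaves_grow_tree simp del: nleaves_pos)
  show ?case
    by (simp only: grow_tree.simps shift Nd)
qed (use assms in auto)

lemma grow_tree_eq_Lf: "grow_tree t a i = Lf \<Longrightarrow> t = Lf"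
  by (cases t) auto

text \<open>A terminal node to the right of the new one was there before, with label one lower.
  Label \<open>Suc i\<close> is excluded because that leaf is the right child of the new
  node.\<close>

lemma term_rhos_grow_tree:
  assumes "j \<in> term_rhos (grow_tree t a i) (a + of_bool (i < a))" "i < j"
  shows "Suc i < j \<and> j - 1 \<in> term_rhos t a"
  using assms
proof (induction t arbitrary: a)
  case (Nd l r)
  have shift: "a + of_bool (i < a) + nleaves (grow_tree l a i) =
      a + nleaves l + of_bool (i < a + nleaves l)"
    using nleaves_pos[of l] by (auto simp: nleaves_grow_tree simp del: nleaves_pos)
  show ?case
  proof (cases "l = Lf \<and> r = Lf")
    case True
    with Nd.prems show ?thesis by (cases "i < a") (auto split: if_splits)
  next
    case False
    then have "\<not> (grow_tree l a i = Lf \<and> grow_tree r (a + nleaves l) i = Lf)"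
      using grow_tree_eq_Lf by blast
    then have "j \<in> term_rhos (grow_tree l a i) (a + of_bool (i < a)) \<or>
        j \<in> term_rhos (grow_tree r (a + nleaves l) i) (a + nleaves l + of_bool (i < a + nleaves l))"
      using Nd.prems(1) by (simp only: grow_tree.simps term_rhos_Nd shift if_False Un_iff)
    then have "Suc i < j \<and> (j - 1 \<in> term_rhos l a \<or> j - 1 \<in> term_rhos r (a + nleaves l))"
      using Nd.IH Nd.prems(2) by blast
    then show ?thesis using False by auto
  qed
qed (auto split: if_splits)

section \<open>From trees to forests\<close>

lemma offset_Suc: "offset F (Suc k) = offset F k + nleaves (F k)"
  by (simp add: offset_def)

lemma offset_mono: "k \<le> l \<Longrightarrow> offset F k \<le> offset F l"
  unfolding offset_def by (rule sum_mono2) auto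

lemma offset_ge: "k \<le> offset F k"
proof (induction k)
  case (Suc k)
  then show ?case using nleaves_pos[of "F k"] unfolding offset_Suc by linarith
qed simp

lemma offset_locate:
  obtains k where "offset F k \<le> i" "i < offset F k + nleaves (F k)"
proof -
  \<comment> \<open>The first tree starting beyond leaf i; the leaf lies in the tree before
    it.\<close>
  define l where "l = (LEAST l. i < offset F l)"
  have "i < offset F (Suc i)" using offset_ge[of "Suc i" F] by simp
  then have l: "i < offset F l" unfolding l_def by (rule LeastI)
  then obtain k where k: "l = Suc k" by (cases l) (auto simp: offset_def)
  have "\<not> i < offset F k" by (rule not_less_Least) (simp add: k flip: l_def)
  then show thesis using that[of k] l by (simp add: k offset_Suc)
qed

lemma offset_unlocate:
  assumes "offset F k \<le> i" "i < offset F k + nleaves (F k)" "l \<noteq> k"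
  shows "i < offset F l \<or> offset F l + nleaves (F l) \<le> i"
  using assms offset_mono[of "Suc k" l F] offset_mono[of "Suc l" k F]
  by (auto simp: offset_Suc not_less_eq_eq linorder_neq_iff)

lemma offset_fun_upd: "k \<le> l \<Longrightarrow> offset (F(l := t)) k = offset F k"
  unfolding offset_def by (rule sum.cong) auto

text \<open>Only the tree containing leaf \<open>i\<close> changes, which reduces forest statements
  to a single tree.\<close>

lemma grow_eq_fun_upd:
  assumes "offset F k \<le> i" "i < offset F k + nleaves (F k)"
  shows "grow F i = F(k := grow_tree (F k) (offset F k) i)"
  using offset_unlocate[OF assms] by (auto simp: grow_def fun_eq_iff grow_tree_outside)

lemma contract_eq_fun_upd:
  assumes "offset F k \<le> i" "i < offset F k + nleaves (F k)"
  shows "contract F i = F(k := contract_tree (F k) (offset F k) i)"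
  using offset_unlocate[OF assms] by (auto simp: contract_def fun_eq_iff contract_tree_outside)

lemma contract_grow: "contract (grow F i) i = F"
  and Qdes_grow_self: "i \<in> Qdes (grow F i)"
proof -
  obtain k where k: "offset F k \<le> i" "i < offset F k + nleaves (F k)" by (rule offset_locate)
  let ?G = "F(k := grow_tree (F k) (offset F k) i)"
  have off: "offset ?G k = offset F k" by (rule offset_fun_upd) simp
  have "contract ?G i = ?G(k := contract_tree (?G k) (offset ?G k) i)"
    by (rule contract_eq_fun_upd) (use k in \<open>simp_all add: off nleaves_grow_tree\<close>)
  then show "contract (grow F i) i = F"
    using k by (simp add: off contract_grow_tree grow_eq_fun_upd)
  have "i \<in> term_rhos (?G k) (offset ?G k)" using k by (simp add: off contract_grow_tree)
  then show "i \<in> Qdes (grow F i)"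
    unfolding grow_eq_fun_upd[OF k] Qdes_def by blast
qed

lemma grow_contract:
  assumes "i \<in> Qdes F"
  shows "grow (contract F i) i = F"
proof -
  obtain k where mem: "i \<in> term_rhos (F k) (offset F k)" using assms by (auto simp: Qdes_def)
  then have k: "offset F k \<le> i" "Suc i < offset F k + nleaves (F k)"
    using term_rhos_bounds by blast+
  let ?G = "F(k := contract_tree (F k) (offset F k) i)"
  have off: "offset ?G k = offset F k" by (rule offset_fun_upd) simp
  have "grow ?G i = ?G(k := grow_tree (?G k) (offset ?G k) i)"
    by (rule grow_eq_fun_upd) (use k nleaves_contract_tree[OF mem] in \<open>simp_all add: off\<close>)
  then show ?thesis
    using k mem by (simp add: off grow_contract_tree contract_eq_fun_upd)
qed

lemma offset_grow: "offset (grow F i) k = offset F k + of_bool (i < offset F k)"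
proof (induction k)
  case (Suc k)
  show ?case
    unfolding offset_Suc Suc using nleaves_pos[of "F k"]
    by (auto simp: grow_def nleaves_grow_tree simp del: nleaves_pos)
qed (simp add: offset_def)

lemma grow_commute: "i < j \<Longrightarrow> grow (grow F i) (Suc j) = grow (grow F j) i"
  unfolding grow_def[of "grow F _"] offset_grow
  by (simp add: grow_def grow_tree_commute del: of_bool_eq_1_iff)

lemma Qdes_grow_greater:
  assumes "j \<in> Qdes (grow F i)" "i < j"
  obtains j' where "j = Suc j'" "i < j'" "j' \<in> Qdes F"
proof -
  obtain k where "j \<in> term_rhos (grow_tree (F k) (offset F k) i) (offset F k + of_bool (i < offset F k))"
    using assms(1) by (auto simp: Qdes_def grow_def offset_grow[unfolded grow_def])
  from term_rhos_grow_tree[OF this assms(2)] have "Suc i < j" "j - 1 \<in> Qdes F"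
    by (auto simp: Qdes_def)
  then show thesis by (intro that[of "j - 1"]) auto
qed

text \<open>The number of internal nodes, since a binary tree has one more leaf than internal
  nodes.\<close>

definition fsize :: "(nat \<Rightarrow> tree) \<Rightarrow> nat" where
  "fsize F = (\<Sum>k | F k \<noteq> Lf. nleaves (F k) - 1)"

lemma is_forest_fun_upd [simp]: "is_forest (F(k := t)) \<longleftrightarrow> is_forest F"
proof -
  have "{l. (F(k := t)) l \<noteq> Lf} \<subseteq> insert k {l. F l \<noteq> Lf}"
    "{l. F l \<noteq> Lf} \<subseteq> insert k {l. (F(k := t)) l \<noteq> Lf}" by auto
  then show ?thesis unfolding is_forest_def by (meson finite_insert finite_subset)
qed

lemma fsize_fun_upd:
  assumes "is_forest F"
  shows "fsize (F(k := t)) + nleaves (F k) = fsize F + nleaves t"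
proof -
  let ?S = "insert k {l. F l \<noteq> Lf}"
  have fin: "finite ?S" using assms by (simp add: is_forest_def)
  have sup: "fsize G = (\<Sum>l\<in>?S. nleaves (G l) - 1)" if "\<And>l. l \<noteq> k \<Longrightarrow> G l = F l" for G
    unfolding fsize_def by (rule sum.mono_neutral_left[OF fin]) (auto simp: that)
  have "fsize F = (nleaves (F k) - 1) + (\<Sum>l\<in>?S - {k}. nleaves (F l) - 1)"
    using fin by (subst sup) (simp_all add: sum.remove[of ?S k])
  moreover have "fsize (F(k := t)) = (nleaves t - 1) + (\<Sum>l\<in>?S - {k}. nleaves (F l) - 1)"
    using fin by (subst sup) (simp_all add: sum.remove[of ?S k])
  ultimately show ?thesis using nleaves_pos[of t] nleaves_pos[of "F k"] by linarith
qed

lemma is_forest_grow [simp]: "is_forest (grow F i) \<longleftrightarrow> is_forest F"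
  by (rule offset_locate[of F i]) (simp add: grow_eq_fun_upd)

lemma fsize_grow: "is_forest F \<Longrightarrow> fsize (grow F i) = Suc (fsize F)"
proof -
  assume F: "is_forest F"
  obtain k where k: "offset F k \<le> i" "i < offset F k + nleaves (F k)" by (rule offset_locate)
  then show ?thesis
    using fsize_fun_upd[OF F, of k "grow_tree (F k) (offset F k) i"]
    by (simp add: grow_eq_fun_upd nleaves_grow_tree)
qed

lemma is_forest_contract: "is_forest F \<Longrightarrow> i \<in> Qdes F \<Longrightarrow> is_forest (contract F i)"
  by (metis grow_contract is_forest_grow)

lemma fsize_contract: "is_forest F \<Longrightarrow> i \<in> Qdes F \<Longrightarrow> fsize F = Suc (fsize (contract F i))"
  by (metis grow_contract is_forest_contract fsize_grow)

lemma term_rhos_nonempty: "t \<noteq> Lf \<Longrightarrow> term_rhos t a \<noteq> {}"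
  by (induction t arbitrary: a) auto

lemma Qdes_nonempty: "F \<noteq> empty_forest \<Longrightarrow> Qdes F \<noteq> {}"
  using term_rhos_nonempty unfolding Qdes_def empty_forest_def fun_eq_iff by fastforce

lemma Qdes_empty_forest [simp]: "Qdes empty_forest = {}"
  by (simp add: Qdes_def empty_forest_def)

lemma is_forest_empty_forest [simp]: "is_forest empty_forest"
  by (simp add: is_forest_def empty_forest_def)

lemma fsize_empty_forest [simp]: "fsize empty_forest = 0"
  by (simp add: fsize_def empty_forest_def)

lemma grow_neq_empty_forest [simp]: "grow F i \<noteq> empty_forest"
  using Qdes_grow_self[of i F] by force

lemma finite_term_rhos: "finite (term_rhos t a)"
  by (rule finite_subset[of _ "{..a + nleaves t}"]) (use term_rhos_bounds in fastforce)+

lemma finite_Qdes: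
  assumes "is_forest F"
  shows "finite (Qdes F)"
proof -
  have "Qdes F \<subseteq> (\<Union>k\<in>{k. F k \<noteq> Lf}. term_rhos (F k) (offset F k))"
  proof
    fix i assume "i \<in> Qdes F"
    then obtain k where k: "i \<in> term_rhos (F k) (offset F k)" by (auto simp: Qdes_def)
    then have "F k \<noteq> Lf" by auto
    with k show "i \<in> (\<Union>k\<in>{k. F k \<noteq> Lf}. term_rhos (F k) (offset F k))" by blast
  qed
  then show ?thesis
    by (rule finite_subset) (use assms in \<open>auto simp: is_forest_def finite_term_rhos\<close>)
qed

section \<open>Existence and uniqueness of double forest polynomials\<close>

lemma homog_tev: "homog d f \<Longrightarrow> homog d (tev s f)"
  unfolding tev_def by (erule homog_xsub) (simp add: T_def homog_mvar[simplified])

lemma qdd_tev [simp]: "qdd i k (tev s f) = 0"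
  by (rule qdd_eq_0) (simp add: ins_def)

lemma tev_tev [simp]: "tev r (tev s f) = tev s f"
  by (simp add: tev_def[of r])

text \<open>Recursion on the number of internal nodes, which is also the prescribed degree. That the
  choice has a solution is shown in \<open>dfp_properties\<close>.\<close>

function dfp :: "(nat \<Rightarrow> tree) \<Rightarrow> xtpoly" where
  "dfp F = (if is_forest F then
     (SOME f. homog (fsize F) f \<and> tev id f = (if F = empty_forest then 1 else 0) \<and>
        (\<forall>i. qdd i i f = (if i \<in> Qdes F then tsub (skip i) (dfp (contract F i)) else 0)))
     else 0)"
  by pat_completeness auto
termination by (relation "measure fsize") (auto simp: fsize_contract)

declare dfp.simps [simp del]

lemma dfp_properties:
  assumes "is_forest F"
  shows "homog (fsize F) (dfp F) \<and> tev id (dfp F) = (if F = empty_forest then 1 else 0) \<and>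
    (\<forall>i. qdd i i (dfp F) = (if i \<in> Qdes F then tsub (skip i) (dfp (contract F i)) else 0))"
  using assms
proof (induction "fsize F" arbitrary: F rule: less_induct)
  case less
  define g where "g i = (if i \<in> Qdes F then tsub (skip i) (dfp (contract F i)) else 0)" for i
  note IH = less.hyps[OF _ is_forest_contract[OF less.prems]]
  have contracted: "homog (fsize (contract F i)) (dfp (contract F i))"
    "qdd j j (dfp (contract F i)) = (if j \<in> Qdes (contract F i)
      then tsub (skip j) (dfp (contract (contract F i) j)) else 0)"
    if "i \<in> Qdes F" for i j
    using IH[OF _ that] fsize_contract[OF less.prems that] that by auto
  define R where "R f \<longleftrightarrow> homog (fsize F) f \<and>
      tev id f = (if F = empty_forest then 1 else 0) \<and> (\<forall>i. qdd i i f = g i)" for f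
  have ex: "\<exists>f. R f"
  proof (cases "F = empty_forest")
    case True
    have "homog 0 (1 :: xtpoly)" by (simp add: homog_def scale2_def)
    moreover have "qdd i i 1 = 0" for i by (rule qdd_eq_0) simp
    ultimately show ?thesis using True by (intro exI[of _ 1]) (simp add: R_def g_def)
  next
    case False
    then obtain i0 where i0: "i0 \<in> Qdes F" using Qdes_nonempty by blast
    define d where "d = fsize (contract F i0)"
    have d: "fsize F = Suc d" using fsize_contract[OF less.prems i0] by (simp add: d_def)
    have "\<exists>f. homog (Suc d) f \<and> (\<forall>i. qdd i i f = g i)"
    proof (rule qdd_integrate)
      show "homog d (g i)" for i
        using contracted(1)[of i] fsize_contract[OF less.prems, of i] d
        by (auto simp: g_def intro!: homog_tsub)
      show "g i = 0" if "Suc (Max (Qdes F)) \<le> i" for i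
        using that Max_ge[OF finite_Qdes[OF less.prems], of i] by (auto simp: g_def)
      fix i j :: nat assume ij: "i < j"
      show "qdd i i (g (Suc j)) = qdd j (Suc j) (g i)"
      proof -
        \<comment> \<open>\<open>skip (Suc j)\<close> fixes i, while \<open>skip i\<close> sends j
          to \<open>Suc j\<close>; this matches the parameters on the two sides.\<close>
        have lhs: "qdd i i (g (Suc j)) =
          (if Suc j \<in> Qdes F \<and> i \<in> Qdes (contract F (Suc j))
           then tsub (skip (Suc j) \<circ> skip i) (dfp (contract (contract F (Suc j)) i)) else 0)"
          using qdd_tsub[of i "skip (Suc j)" i "dfp (contract F (Suc j))"] ij contracted(2)[of "Suc j" i]
          by (simp add: g_def skip_def[of "Suc j" i] tsub_tsub)
        have rhs: "qdd j (Suc j) (g i) =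
          (if i \<in> Qdes F \<and> j \<in> Qdes (contract F i)
           then tsub (skip i \<circ> skip j) (dfp (contract (contract F i) j)) else 0)"
          using qdd_tsub[of j "skip i" j "dfp (contract F i)"] ij contracted(2)[of i j]
          by (simp add: g_def skip_def[of i j] tsub_tsub)
        show ?thesis
        \<comment> \<open>Either both sides come from the same forest \<open>L\<close> with two
          nodes removed in different orders, or both are 0.\<close>
        proof (cases "\<exists>L. F = grow (grow L j) i")
          case True
          then obtain L where L: "F = grow (grow L j) i" by blast
          then have "F = grow (grow L i) (Suc j)" by (simp add: grow_commute[OF ij])
          then have "Suc j \<in> Qdes F" "i \<in> Qdes (contract F (Suc j))"
            "contract (contract F (Suc j)) i = L"
            by (simp_all add: contract_grow Qdes_grow_self)
          moreover from L have "i \<in> Qdes F" "j \<in> Qdes (contract F i)"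
            "contract (contract F i) j = L"
            by (simp_all add: contract_grow Qdes_grow_self)
          ultimately show ?thesis
            unfolding lhs rhs using skip_comp_skip[of i j] ij by simp
        next
          case False
          have "\<not> (i \<in> Qdes F \<and> j \<in> Qdes (contract F i))"
            using False by (metis grow_contract)
          moreover have "\<not> (Suc j \<in> Qdes F \<and> i \<in> Qdes (contract F (Suc j)))"
            using False by (metis grow_contract grow_commute[OF ij])
          ultimately show ?thesis by (simp only: lhs rhs if_False)
        qed
      qed
    qed
    then obtain f where f: "homog (Suc d) f" "\<And>i. qdd i i f = g i" by blast
    \<comment> \<open>Subtracting the value at x = t makes the evaluation vanish without changing
      any divided difference.\<close>
    have "homog (Suc d) (f - tev id f)" using f(1) by (intro homog_diff homog_tev)
    then show ?thesis
      using False f(2) d by (intro exI[of _ "f - tev id f"]) (simp add: R_def qdd_diff)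
  qed
  have "dfp F = (SOME f. R f)"
    unfolding R_def g_def by (subst dfp.simps) (simp only: less.prems if_True)
  then have "R (dfp F)" using someI_ex[OF ex] by simp
  then show ?case unfolding R_def g_def .
qed

lemma homog_dfp: "is_forest F \<Longrightarrow> homog (fsize F) (dfp F)"
  and tev_dfp: "is_forest F \<Longrightarrow> tev id (dfp F) = (if F = empty_forest then 1 else 0)"
  and qdd_dfp: "is_forest F \<Longrightarrow>
    qdd i i (dfp F) = (if i \<in> Qdes F then tsub (skip i) (dfp (contract F i)) else 0)"
  using dfp_properties[of F] by simp_all

lemma dfp_not_forest: "\<not> is_forest F \<Longrightarrow> dfp F = 0"
  by (subst dfp.simps) (simp only: if_False)

lemma is_dfp_family_dfp: "is_dfp_family dfp"
  unfolding is_dfp_family_def Eop_eq_qdd hat_t_eq_tsub eval_x_at_t_eq_tev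
  by (simp add: dfp_not_forest homog_imp_homogeneous[OF homog_dfp] tev_dfp qdd_dfp)

text \<open>By induction on size the axioms fix all divided differences and the value at x = t, and
  these determine the polynomial.\<close>

lemma dfp_family_unique:
  assumes "is_dfp_family P"
  shows "P = dfp"
proof
  fix F
  have forest: "P F = dfp F" if "is_forest F" for F
    using that
  proof (induction "fsize F" arbitrary: F rule: less_induct)
    case less
    have P: "tev id (P F) = (if F = empty_forest then 1 else 0)"
      "\<And>i. qdd i i (P F) = (if i \<in> Qdes F then tsub (skip i) (P (contract F i)) else 0)"
      using assms[unfolded is_dfp_family_def Eop_eq_qdd hat_t_eq_tsub eval_x_at_t_eq_tev,
          THEN conjunct2, rule_format, OF less.prems]
      by simp_all
    have "P (contract F i) = dfp (contract F i)" if "i \<in> Qdes F" for i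
      using less.hyps[OF _ is_forest_contract[OF less.prems that]] fsize_contract[OF less.prems that]
      by simp
    then have "qdd i (id i) (P F) = qdd i (id i) (dfp F)" for i
      by (simp add: P(2) qdd_dfp[OF less.prems])
    moreover have "tev id (P F) = tev id (dfp F)"
      by (simp only: P(1) tev_dfp[OF less.prems])
    ultimately show ?case by (rule eq_if_qdd_eq)
  qed
  show "P F = dfp F"
  proof (cases "is_forest F")
    case False
    then show ?thesis
      using assms[unfolded is_dfp_family_def, THEN conjunct1] by (simp only: dfp_not_forest simp_thms)
  qed (fact forest)
qed

lemma DFP_eq_dfp: "DFP = dfp"
  unfolding DFP_def using is_dfp_family_dfp dfp_family_unique by (rule the_equality)

section \<open>Coefficient functionals\<close>

text \<open>\<open>coef s H f\<close> is the coefficient of \<open>tsub s (dfp H)\<close> in f; coefficients range over the whole ring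
  of polynomials in the t-variables, also those that s omits.\<close>

function coef :: "(nat \<Rightarrow> nat) \<Rightarrow> (nat \<Rightarrow> tree) \<Rightarrow> xtpoly \<Rightarrow> xtpoly" where
  "coef s H f =
    (if is_forest H \<and> H \<noteq> empty_forest
     then coef (s \<circ> skip (Max (Qdes H))) (contract H (Max (Qdes H)))
       (qdd (Max (Qdes H)) (s (Max (Qdes H))) f)
     else tev s f)"
  by pat_completeness auto
termination
  by (relation "measure (\<lambda>(s, H, f). fsize H)")
    (simp_all add: fsize_contract[OF _ Max_in] finite_Qdes Qdes_nonempty)

declare coef.simps [simp del]

lemma coef_empty_forest: "coef s empty_forest f = tev s f"
  by (subst coef.simps) simp

text \<open>A nonempty forest has a terminal node, so it grows out of a contraction with one
  internal node fewer.\<close>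

lemma forest_induct [consumes 1, case_names empty grow]:
  assumes "is_forest H"
    and "Q empty_forest"
    and "\<And>K i. is_forest K \<Longrightarrow> Q K \<Longrightarrow> Q (grow K i)"
  shows "Q H"
  using assms(1)
proof (induction "fsize H" arbitrary: H rule: less_induct)
  case less
  show ?case
  proof (cases "H = empty_forest")
    case False
    then obtain i where i: "i \<in> Qdes H" using Qdes_nonempty by blast
    have "Q (contract H i)"
      using less.hyps[OF _ is_forest_contract[OF less.prems i]] fsize_contract[OF less.prems i]
      by simp
    then have "Q (grow (contract H i) i)"
      using assms(3) is_forest_contract[OF less.prems i] by blast
    then show ?thesis by (simp add: grow_contract[OF i])
  qed (simp add: assms(2))
qed

text \<open>The recursion for \<open>coef\<close> may be started at any element of \<open>Qdes\<close>, not just the maximum.\<close>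

lemma coef_grow:
  assumes "is_forest K"
  shows "coef s (grow K i) f = coef (s \<circ> skip i) K (qdd i (s i) f)"
  using assms
proof (induction "fsize K" arbitrary: K s f i rule: less_induct)
  case less
  define n where "n = Max (Qdes (grow K i))"
  have fin: "finite (Qdes (grow K i))" using less.prems by (simp add: finite_Qdes)
  have "i \<le> n" unfolding n_def by (rule Max_ge[OF fin Qdes_grow_self])
  have n: "n \<in> Qdes (grow K i)"
    unfolding n_def using Max_in[OF fin] Qdes_grow_self[of i K] by blast
  have step: "coef s (grow K i) f = coef (s \<circ> skip n) (contract (grow K i) n) (qdd n (s n) f)"
    using less.prems by (subst coef.simps) (simp add: n_def)
  show ?case
  proof (cases "i = n")
    case True
    with step show ?thesis by (simp add: contract_grow)
  next
    case False
    with \<open>i \<le> n\<close> have "i < n" by simp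
    \<comment> \<open>The node with the larger label is already terminal in \<open>K\<close>, one
      label lower, so the two nodes can be removed in either order.\<close>
    with n obtain m where m: "n = Suc m" "i < m" "m \<in> Qdes K" by (rule Qdes_grow_greater)
    define L where "L = contract K m"
    have K: "K = grow L m" using m(3) by (simp add: L_def grow_contract)
    have L: "is_forest L" "fsize L < fsize K"
      using less.prems by (auto simp: K fsize_grow)
    have contr: "contract (grow K i) n = grow L i"
      unfolding K m(1) grow_commute[OF m(2), symmetric] by (rule contract_grow)
    have "coef s (grow K i) f = coef (s \<circ> skip n \<circ> skip i) L (qdd i ((s \<circ> skip n) i) (qdd n (s n) f))"
      unfolding step contr using less.hyps[OF L(2,1)] by simp
    also have "(s \<circ> skip n) i = s i" using \<open>i < n\<close> by (simp add: skip_def)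
    also have "qdd i (s i) (qdd n (s n) f) = qdd m ((s \<circ> skip i) m) (qdd i (s i) f)"
      using m by (simp add: qdd_commute skip_def)
    also have "s \<circ> skip n \<circ> skip i = s \<circ> skip i \<circ> skip m"
      using skip_comp_skip[of i m] m by (simp add: comp_assoc)
    also have "coef (s \<circ> skip i \<circ> skip m) L (qdd m ((s \<circ> skip i) m) (qdd i (s i) f)) =
        coef (s \<circ> skip i) K (qdd i (s i) f)"
      unfolding K using less.hyps[OF L(2,1)] by simp
    finally show ?thesis .
  qed
qed

lemma coef_add: "is_forest H \<Longrightarrow> coef s H (f + g) = coef s H f + coef s H g"
  by (induction H arbitrary: s f g rule: forest_induct)
    (simp_all add: coef_empty_forest coef_grow qdd_add)

lemma coef_0: "is_forest H \<Longrightarrow> coef s H 0 = 0"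
  by (induction H arbitrary: s rule: forest_induct) (simp_all add: coef_empty_forest coef_grow)

lemma coef_diff: "is_forest H \<Longrightarrow> coef s H (f - g) = coef s H f - coef s H g"
  by (induction H arbitrary: s f g rule: forest_induct)
    (simp_all add: coef_empty_forest coef_grow qdd_diff)

lemma coef_sum: "is_forest H \<Longrightarrow> coef s H (sum f S) = (\<Sum>x\<in>S. coef s H (f x))"
  by (induction S rule: infinite_finite_induct) (simp_all add: coef_0 coef_add)

text \<open>The hypothesis expresses that \<open>c\<close> contains no x-variable.\<close>

lemma qdd_scale_const:
  assumes "\<And>u. xsub u c = c"
  shows "qdd i k (c * f) = c * qdd i k f"
  by (rule qdd_scale) (simp_all add: ins_def assms)

lemma coef_scale:
  assumes "\<And>u. xsub u c = c" "is_forest H"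
  shows "coef s H (c * f) = c * coef s H f"
  using assms(2)
  by (induction H arbitrary: s f rule: forest_induct)
    (simp_all add: coef_empty_forest coef_grow qdd_scale_const assms(1) tev_def)

text \<open>Duality: E_i contracts \<open>G\<close> at i, or gives 0 if i is not terminal in
  \<open>G\<close>, just as the recursion strips i from \<open>grow K i\<close>. The values at x = t
  start the induction.\<close>

lemma coef_dfp:
  assumes "is_forest H" "is_forest G"
  shows "coef s H (tsub s (dfp G)) = (if H = G then 1 else 0)"
  using assms
proof (induction H arbitrary: s G rule: forest_induct)
  case empty
  have "tev s (tsub s (dfp G)) = tsub s (tev id (dfp G))" by (simp add: tsub_tev)
  then show ?case using empty by (auto simp: coef_empty_forest tev_dfp)
next
  case (grow K i)
  have "coef s (grow K i) (tsub s (dfp G)) = coef (s \<circ> skip i) K (tsub s (qdd i i (dfp G)))"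
    using grow.hyps by (simp add: coef_grow qdd_tsub)
  also have "\<dots> = (if grow K i = G then 1 else 0)"
  proof (cases "i \<in> Qdes G")
    case True
    have "coef (s \<circ> skip i) K (tsub s (qdd i i (dfp G))) =
        coef (s \<circ> skip i) K (tsub (s \<circ> skip i) (dfp (contract G i)))"
      using True grow.prems by (simp add: qdd_dfp tsub_tsub)
    also have "\<dots> = (if K = contract G i then 1 else 0)"
      using True grow.prems by (intro grow.IH is_forest_contract)
    also have "K = contract G i \<longleftrightarrow> grow K i = G"
      using True grow_contract contract_grow by metis
    finally show ?thesis .
  next
    case False
    then have "grow K i \<noteq> G" using Qdes_grow_self by blast
    with False show ?thesis using grow by (simp add: qdd_dfp coef_0)
  qed
  finally show ?case .
qed

section \<open>Graham positivity\<close>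

lemma graham_positive_0: "graham_positive 0"
  unfolding graham_positive_def by (rule exI[of _ 0]) simp

lemma graham_positive_1: "graham_positive 1"
  unfolding graham_positive_def by (rule exI[of _ 1]) (simp add: lookup_one when_def)

lemma graham_positive_add:
  assumes "graham_positive p" "graham_positive q"
  shows "graham_positive (p + q)"
proof -
  obtain p' q' :: "nat mpoly" where
    "\<And>m. Poly_Mapping.lookup p' m \<ge> 0" "p = msubst (\<lambda>j. T (j + 1) - T j) p'"
    "\<And>m. Poly_Mapping.lookup q' m \<ge> 0" "q = msubst (\<lambda>j. T (j + 1) - T j) q'"
    using assms unfolding graham_positive_def by blast
  then show ?thesis
    unfolding graham_positive_def by (intro exI[of _ "p' + q'"]) (simp add: lookup_add)
qed

lemma graham_positive_mult:
  assumes "graham_positive p" "graham_positive q"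
  shows "graham_positive (p * q)"
proof -
  obtain p' q' :: "nat mpoly" where
    *: "\<And>m. Poly_Mapping.lookup p' m \<ge> 0" "p = msubst (\<lambda>j. T (j + 1) - T j) p'"
    "\<And>m. Poly_Mapping.lookup q' m \<ge> 0" "q = msubst (\<lambda>j. T (j + 1) - T j) q'"
    using assms unfolding graham_positive_def by blast
  have "Poly_Mapping.lookup (p' * q') m \<ge> 0" for m
    unfolding lookup_mult Sum_any.expand_set
    by (intro sum_nonneg mult_nonneg_nonneg) (auto simp: * when_def)
  then show ?thesis
    unfolding graham_positive_def using * by (intro exI[of _ "p' * q'"]) simp
qed

lemma graham_positive_T_diff: "i \<le> j \<Longrightarrow> graham_positive (T j - T i)"
proof (induction j rule: dec_induct)
  case base
  then show ?case by (simp add: graham_positive_0)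
next
  case (step n)
  have "graham_positive (T (Suc n) - T n)"
    unfolding graham_positive_def
    by (rule exI[of _ "mvar n"]) (simp, simp add: mvar_def lookup_single when_def)
  from graham_positive_add[OF this step.IH] show ?case by simp
qed

text \<open>The basis takes its parameters along \<open>s\<close>, but Graham positivity always
  refers to consecutive differences of the full sequence t.\<close>

definition positive :: "(nat \<Rightarrow> nat) \<Rightarrow> xtpoly \<Rightarrow> bool" where
  "positive s f \<longleftrightarrow> (\<forall>H. is_forest H \<longrightarrow> graham_positive (coef s H f))"

lemma positive_qdd: "positive s f \<Longrightarrow> positive (s \<circ> skip i) (qdd i (s i) f)"
  unfolding positive_def by (metis coef_grow is_forest_grow)

lemma positive_tev: "positive s f \<Longrightarrow> graham_positive (tev s f)"
  unfolding positive_def by (metis coef_empty_forest is_forest_empty_forest)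

lemma positive_dfp: "is_forest G \<Longrightarrow> positive s (tsub s (dfp G))"
  by (simp add: positive_def coef_dfp graham_positive_0 graham_positive_1)

text \<open>Induction on \<open>H\<close>, moving the first divided difference of the coefficient
  past the insertion. Inserting \<open>T (s p)\<close> uses up entry \<open>p\<close> of
  \<open>s\<close>; slots \<open>p\<close> and \<open>Suc p\<close> correspond to R^- and
  R^+.\<close>

lemma graham_positive_coef_ins:
  assumes "is_forest H" "strict_mono s" "positive s f" "p = i \<or> i = Suc p"
  shows "graham_positive (coef (s \<circ> skip p) H (ins i (s p) f))"
  using assms
proof (induction H arbitrary: s f i p rule: forest_induct)
  case empty
  \<comment> \<open>Inserting at slot p restores the omitted entry in its place.\<close>
  have "tev (s \<circ> skip p) (ins p (s p) f) = tev s f"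
    unfolding tev_def ins_def xsub_xsub
    by (rule arg_cong[where f = "\<lambda>u. xsub u f"]) (auto simp: skip_def fun_eq_iff)
  \<comment> \<open>The factor arises from \<open>X p - T (s p)\<close>: entry \<open>p\<close> of
    \<open>s \<circ> skip p\<close> is \<open>s (Suc p)\<close>.\<close>
  moreover have "tev (s \<circ> skip p) (ins (Suc p) (s p) f) = tev (s \<circ> skip p) (ins p (s p) f) +
      (T (s (Suc p)) - T (s p)) * tev (s \<circ> skip p) (qdd p (s p) f)"
    using arg_cong[OF qdd_eq[of p "s p" f], of "tev (s \<circ> skip p)"]
    by (simp add: skip_def algebra_simps)
  moreover have "graham_positive (tev (s \<circ> skip p) (qdd p (s p) f))"
    using empty by (intro positive_tev positive_qdd)
  moreover have "graham_positive (T (s (Suc p)) - T (s p))"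
    using empty by (intro graham_positive_T_diff) (simp add: strict_mono_less_eq)
  ultimately have "graham_positive (tev (s \<circ> skip p) (ins i (s p) f))"
    using empty positive_tev[of s f] by (auto intro!: graham_positive_add graham_positive_mult)
  then show ?case unfolding coef_empty_forest .
next
  case (grow K j)
  \<comment> \<open>The divided difference consumes entry \<open>h\<close> of \<open>s\<close>; the
    insertion then consumes entry \<open>q\<close> of what remains.\<close>
  have IH: "graham_positive (coef (s \<circ> skip h \<circ> skip q) K (ins l (s (skip h q)) (qdd h (s h) f)))"
    if "q = l \<or> l = Suc q" for h q l
    using grow.IH[OF strict_mono_comp_skip[OF grow.prems(1)] positive_qdd[OF grow.prems(2)] that]
    by (simp add: comp_def)
  have diff: "graham_positive (T (s (Suc j)) - T (s j))"
    using grow.prems by (intro graham_positive_T_diff) (simp add: strict_mono_less_eq)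
  have skip_skip: "s \<circ> skip a \<circ> skip b = s \<circ> skip (Suc b) \<circ> skip a" if "a \<le> b" for a b
    using skip_comp_skip[OF that] by (simp add: comp_assoc)
  have coef_eq: "coef (s \<circ> skip p) (grow K j) (ins i (s p) f) =
      coef (s \<circ> skip p \<circ> skip j) K (qdd j (s (skip p j)) (ins i (s p) f))"
    using grow.hyps by (simp add: coef_grow)
  \<comment> \<open>Only an insertion at slot \<open>Suc j\<close> interferes with
    \<open>qdd j\<close>; which of the two parameters is larger then depends on
    \<open>p\<close>.\<close>
  consider (below) "Suc (Suc j) \<le> i" | (above) "i \<le> j"
    | (same) "i = Suc j" "p = Suc j" | (pred) "i = Suc j" "p = j"
    using grow.prems(3) by linarith
  then show ?case
  proof cases
    case below
    then obtain i' p' where ip: "i = Suc i'" "p = Suc p'" "Suc j \<le> i'" "j \<le> p'"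
      "p' = i' \<or> i' = Suc p'"
      using grow.prems(3) by (cases i; cases p) auto
    then have "skip (Suc p') j = j" "skip j p' = Suc p'" by (auto simp: skip_def)
    with ip show ?thesis
      unfolding coef_eq using IH[of p' i' j] skip_skip[of j p'] by (simp add: qdd_ins_below skip_skip)
  next
    case above
    then have p: "p \<le> j" "p < Suc j" using grow.prems(3) by auto
    then show ?thesis
      unfolding coef_eq using IH[of p i "Suc j"] above grow.prems(3)
      by (simp add: skip_def[of p j] skip_def[of "Suc j" p] qdd_ins_above skip_skip)
  next
    \<comment> \<open>The inserted parameter \<open>s (Suc j)\<close> is the larger one, so the
      first middle form has a Graham-positive factor.\<close>
    case same
    have "graham_positive (coef (s \<circ> skip (Suc j) \<circ> skip j) K (ins (Suc j) (s (Suc j)) (qdd j (s j) f)))"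
      using IH[of j "Suc j" j] by (simp add: skip_def[of j j] skip_skip)
    moreover have "graham_positive (coef (s \<circ> skip (Suc j) \<circ> skip j) K (ins j (s j) (qdd (Suc j) (s (Suc j)) f)))"
      using IH[of j j "Suc j"] by (simp add: skip_def[of "Suc j" j])
    moreover have "graham_positive (coef (s \<circ> skip (Suc j) \<circ> skip j) K (qdd j (s j) (qdd (Suc j) (s (Suc j)) f)))"
      using positive_qdd[OF positive_qdd[OF grow.prems(2)], of "Suc j" j] grow.hyps
      by (simp add: skip_def[of "Suc j" j] positive_def)
    ultimately show ?thesis
      unfolding coef_eq using same grow.hyps diff
      by (simp add: skip_def[of "Suc j" j] qdd_ins_middle_gt[of j "s j" "s (Suc j)"] coef_add coef_scale
        graham_positive_add graham_positive_mult)
  next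
    \<comment> \<open>Now the operator carries the larger parameter \<open>s (Suc j)\<close>, so the
      second middle form is the suitable one.\<close>
    case pred
    have "graham_positive (coef (s \<circ> skip j \<circ> skip j) K (ins (Suc j) (s (Suc j)) (qdd j (s j) f)))"
      using IH[of j "Suc j" j] by (simp add: skip_def[of j j])
    moreover have "graham_positive (coef (s \<circ> skip j \<circ> skip j) K (ins j (s j) (qdd (Suc j) (s (Suc j)) f)))"
      using IH[of j j "Suc j"] by (simp add: skip_def[of "Suc j" j] skip_skip)
    moreover have "graham_positive (coef (s \<circ> skip j \<circ> skip j) K (qdd j (s (Suc j)) (qdd j (s j) f)))"
      using positive_qdd[OF positive_qdd[OF grow.prems(2)], of j j] grow.hyps
      by (simp add: skip_def[of j j] positive_def)
    ultimately show ?thesis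
      unfolding coef_eq using pred grow.hyps diff
      by (simp add: skip_def[of j j] qdd_ins_middle_less[of j "s (Suc j)" "s j"] coef_add coef_scale
        graham_positive_add graham_positive_mult)
  qed
qed

lemma positive_ins:
  assumes "strict_mono s" "positive s f" "p = i \<or> i = Suc p"
  shows "positive (s \<circ> skip p) (ins i (s p) f)"
  unfolding positive_def using graham_positive_coef_ins[OF _ assms] by blast

text \<open>In each summand of the Leibniz rule both factors are positive along
  \<open>s \<circ> skip i\<close>, so the induction hypothesis covers their product.\<close>

lemma positive_mult:
  assumes "strict_mono s" "positive s f" "positive s g"
  shows "positive s (f * g)"
proof -
  have "graham_positive (coef s H (f * g))" if "is_forest H" for H
    using that assms
  proof (induction H arbitrary: s f g rule: forest_induct)
    case empty
    then show ?case by (simp add: coef_empty_forest graham_positive_mult positive_tev)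
  next
    case (grow K i)
    note prems = grow.prems
    have "graham_positive (coef (s \<circ> skip i) K (qdd i (s i) f * ins (Suc i) (s i) g))"
      using prems by (intro grow.IH strict_mono_comp_skip positive_qdd positive_ins) auto
    moreover have "graham_positive (coef (s \<circ> skip i) K (ins i (s i) f * qdd i (s i) g))"
      using prems by (intro grow.IH strict_mono_comp_skip positive_qdd positive_ins) auto
    ultimately show ?case
      using grow.hyps by (simp add: coef_grow qdd_mult coef_add graham_positive_add)
  qed
  then show ?thesis by (simp add: positive_def)
qed

section \<open>Finiteness of expansions\<close>

text \<open>Replaces a degree bound: unlike total degree, it is unaffected by multiplication with
  polynomials in t.\<close>

primrec nilpotent :: "nat \<Rightarrow> (nat \<Rightarrow> nat) \<Rightarrow> xtpoly \<Rightarrow> bool" where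
  "nilpotent 0 s f \<longleftrightarrow> f = 0"
| "nilpotent (Suc d) s f \<longleftrightarrow> (\<forall>i. nilpotent d (s \<circ> skip i) (qdd i (s i) f))"

lemma nilpotent_0: "nilpotent d s 0"
  by (induction d arbitrary: s) simp_all

lemma nilpotent_add: "nilpotent d s f \<Longrightarrow> nilpotent d s g \<Longrightarrow> nilpotent d s (f + g)"
  by (induction d arbitrary: s f g) (simp_all add: qdd_add)

lemma nilpotent_diff: "nilpotent d s f \<Longrightarrow> nilpotent d s g \<Longrightarrow> nilpotent d s (f - g)"
  by (induction d arbitrary: s f g) (simp_all add: qdd_diff)

lemma nilpotent_scale:
  assumes "\<And>u. xsub u c = c"
  shows "nilpotent d s f \<Longrightarrow> nilpotent d s (c * f)"
  by (induction d arbitrary: s f) (simp_all add: qdd_scale_const assms)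

lemma nilpotent_Suc: "nilpotent d s f \<Longrightarrow> nilpotent (Suc d) s f"
proof (induction d arbitrary: s f)
  case (Suc d)
  then show ?case by (metis nilpotent.simps(2))
qed simp

lemma nilpotent_mono: "d \<le> e \<Longrightarrow> nilpotent d s f \<Longrightarrow> nilpotent e s f"
  by (induction e rule: dec_induct) (simp_all add: nilpotent_Suc del: nilpotent.simps)

lemma nilpotent_sum:
  assumes "\<And>x. x \<in> S \<Longrightarrow> \<exists>d. nilpotent d s (f x)"
  shows "\<exists>d. nilpotent d s (sum f S)"
  using assms
proof (induction S rule: infinite_finite_induct)
  case (insert x S)
  then obtain d e where "nilpotent d s (f x)" "nilpotent e s (sum f S)" by blast
  then have "nilpotent (max d e) s (f x + sum f S)"
    by (meson max.cobounded1 max.cobounded2 nilpotent_add nilpotent_mono)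
  then show ?case using insert.hyps by auto
qed (auto intro: nilpotent_0)

lemma homog_0_imp_mconst:
  assumes "homog 0 f"
  obtains c where "f = mconst c"
proof -
  have "Poly_Mapping.lookup f m = 0" if nz: "m \<noteq> 0" for m
  proof -
    obtain v where "Poly_Mapping.lookup m v \<noteq> 0"
      using nz by (metis lookup_zero poly_mapping_eqI)
    then have "mdeg m \<noteq> 0" by (auto simp: mdeg_def in_keys_iff)
    then have "0 < mdeg m" by simp
    then have "(1::int) < 2 ^ mdeg m" by (simp add: one_less_power)
    moreover have "2 ^ mdeg m * Poly_Mapping.lookup f m = Poly_Mapping.lookup f m"
      using assms lookup_scale2[of f m] by (simp add: homog_def)
    ultimately show ?thesis by (metis less_irrefl mult_cancel_right1)
  qed
  then have "f = mconst (Poly_Mapping.lookup f 0)"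
    by (intro poly_mapping_eqI) (auto simp: mconst_def lookup_single when_def)
  then show thesis by (rule that)
qed

text \<open>Each divided difference lowers the degree by one, and constants are killed.\<close>

lemma nilpotent_homog: "homog d f \<Longrightarrow> nilpotent (Suc d) s f"
proof (induction d arbitrary: s f)
  case 0
  then obtain c where "f = mconst c" by (rule homog_0_imp_mconst)
  then show ?case by (simp add: qdd_eq_0)
next
  case (Suc d)
  then show ?case by (subst nilpotent.simps) (blast intro: homog_qdd)
qed

text \<open>A nonempty \<open>H\<close> is grown at some label i, and only the finitely many i below
  the number of x-variables of f can contribute; induction bounds the forests for each i.\<close>

lemma finite_coef_support: "nilpotent d s f \<Longrightarrow> finite {H. is_forest H \<and> coef s H f \<noteq> 0}"
proof (induction d arbitrary: s f)
  case 0
  then show ?case by (simp add: coef_0 cong: conj_cong)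
next
  case (Suc d)
  obtain N where N: "xbound N f" using xbound_exists by blast
  let ?S = "\<lambda>i. {K. is_forest K \<and> coef (s \<circ> skip i) K (qdd i (s i) f) \<noteq> 0}"
  have "{H. is_forest H \<and> coef s H f \<noteq> 0} \<subseteq> insert empty_forest (\<Union>i<N. (\<lambda>K. grow K i) ` ?S i)"
  proof clarify
    fix H assume H: "is_forest H" "coef s H f \<noteq> 0"
      "H \<notin> (\<Union>i<N. (\<lambda>K. grow K i) ` ?S i)"
    show "H = empty_forest"
    proof (rule ccontr)
      assume "H \<noteq> empty_forest"
      then obtain i where i: "i \<in> Qdes H" using Qdes_nonempty by blast
      let ?K = "contract H i"
      have K: "is_forest ?K" "H = grow ?K i"
        using i H(1) by (simp_all add: is_forest_contract grow_contract)
      then have *: "coef (s \<circ> skip i) ?K (qdd i (s i) f) \<noteq> 0" using H(2) coef_grow by metis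
      then have "i < N" using qdd_xbound[OF N, of i "s i"] coef_0 K(1) by (metis not_le)
      then show False using H(3) K * by blast
    qed
  qed
  moreover have "finite (?S i)" for i by (rule Suc.IH) (use Suc.prems in \<open>simp add: comp_def\<close>)
  ultimately show ?case by (auto intro: finite_subset)
qed

text \<open>The coefficients of the divided differences are coefficients of f, so the divided
  differences vanish by induction; the coefficient at the empty forest is the evaluation.\<close>

lemma nilpotent_eq_0:
  assumes "nilpotent d s f" "\<And>H. is_forest H \<Longrightarrow> coef s H f = 0"
  shows "f = 0"
  using assms
proof (induction d arbitrary: s f)
  case 0
  from 0(1) show ?case by simp
next
  case (Suc d)
  show ?case
  proof (rule eq_0_if_qdd_eq_0)
    show "qdd i (s i) f = 0" for i
    proof (rule Suc.IH)
      show "nilpotent d (s \<circ> skip i) (qdd i (s i) f)" using Suc.prems(1) by simp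
      show "coef (s \<circ> skip i) K (qdd i (s i) f) = 0" if "is_forest K" for K
        unfolding coef_grow[OF that, symmetric] by (rule Suc.prems(2)) (simp add: that)
    qed
    show "tev s f = 0"
      unfolding coef_empty_forest[symmetric] by (rule Suc.prems(2)) simp
  qed
qed

section \<open>Expansions with coefficients in the t-variables\<close>

lemma xsub_in_Zt:
  assumes "in_Zt c"
  shows "xsub u c = c"
proof -
  have "xsub u c = msubst mvar c"
    unfolding xsub_def msubst_def
  proof (intro sum.cong prod.cong arg_cong2[where f = "(*)"] arg_cong2[where f = "(^)"] refl)
    fix m v assume "m \<in> Poly_Mapping.keys c" "v \<in> Poly_Mapping.keys m"
    then obtain j where "v = Inr j" using assms unfolding in_Zt_def by blast
    then show "case_sum u T v = mvar v" by (simp add: T_def)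
  qed
  then show ?thesis by simp
qed

lemma in_Zt_add: "in_Zt p \<Longrightarrow> in_Zt q \<Longrightarrow> in_Zt (p + q)"
  unfolding in_Zt_def using keys_add[of p q] by blast

lemma in_Zt_mult:
  assumes "in_Zt p" "in_Zt q"
  shows "in_Zt (p * q)"
  unfolding in_Zt_def
proof (intro ballI)
  fix m v assume "m \<in> Poly_Mapping.keys (p * q)" and v: "v \<in> Poly_Mapping.keys m"
  then obtain a b where "m = a + b" "a \<in> Poly_Mapping.keys p" "b \<in> Poly_Mapping.keys q"
    using keys_mult[of p q] by blast
  with v assms keys_add[of a b] show "\<exists>j. v = Inr j" unfolding in_Zt_def by blast
qed

lemma in_Zt_tev: "in_Zt (tev s f)"
proof (induction f rule: mpoly_induct)
  case (mvar v)
  have "in_Zt (T j)" for j by (simp add: in_Zt_def T_def mvar_def)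
  then show ?case by (cases v) (simp_all flip: X_def T_def)
qed (simp_all add: in_Zt_add in_Zt_mult, simp add: in_Zt_def mconst_def)

lemma in_Zt_coef: "is_forest H \<Longrightarrow> in_Zt (coef s H f)"
  by (induction H arbitrary: s f rule: forest_induct)
    (simp_all add: coef_empty_forest coef_grow in_Zt_tev)

text \<open>By duality \<open>coef id K\<close> picks out a single summand, so expansions are
  unique.\<close>

lemma coef_expansion:
  assumes "finite S" "\<And>H. H \<in> S \<Longrightarrow> is_forest H \<and> in_Zt (c H)" "is_forest K"
  shows "coef id K (\<Sum>H\<in>S. c H * dfp H) = (if K \<in> S then c K else 0)"
proof -
  have "coef id K (\<Sum>H\<in>S. c H * dfp H) = (\<Sum>H\<in>S. if K = H then c H else 0)"
    unfolding coef_sum[OF assms(3)]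
  proof (rule sum.cong[OF refl])
    fix H assume "H \<in> S"
    with assms(2) have H: "is_forest H" "in_Zt (c H)" by auto
    then have "coef id K (c H * dfp H) = c H * coef id K (tsub id (dfp H))"
      by (simp add: coef_scale xsub_in_Zt assms(3))
    then show "coef id K (c H * dfp H) = (if K = H then c H else 0)"
      using H assms(3) by (simp only: coef_dfp) simp
  qed
  then show ?thesis using assms(1) by simp
qed

theorem theorem11p6:
  assumes "is_forest F" and "is_forest G"
  shows "(\<exists>c :: (nat \<Rightarrow> tree) \<Rightarrow> xtpoly.
            finite {H. c H \<noteq> 0} \<and>
            (\<forall>H. c H \<noteq> 0 \<longrightarrow> is_forest H \<and> in_Zt (c H)) \<and>
            DFP F * DFP G = (\<Sum>H\<in>{H. c H \<noteq> 0}. c H * DFP H))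
       \<and> (\<forall>c :: (nat \<Rightarrow> tree) \<Rightarrow> xtpoly.
            finite {H. c H \<noteq> 0} \<and>
            (\<forall>H. c H \<noteq> 0 \<longrightarrow> is_forest H \<and> in_Zt (c H)) \<and>
            DFP F * DFP G = (\<Sum>H\<in>{H. c H \<noteq> 0}. c H * DFP H)
            \<longrightarrow> (\<forall>H. is_forest H \<longrightarrow> graham_positive (c H)))"
proof -
  define f where "f = dfp F * dfp G"
  have "homog (fsize F + fsize G) f"
    unfolding f_def using assms by (intro homog_mult homog_dfp)
  then have nil: "nilpotent (Suc (fsize F + fsize G)) id f" by (rule nilpotent_homog)
  \<comment> \<open>The only possible coefficients; the default 0 keeps non-forests out of the
    support.\<close>
  define c where "c H = (if is_forest H then coef id H f else 0)" for H
  let ?S = "{H. c H \<noteq> 0}"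
  have fin: "finite ?S"
    using finite_coef_support[OF nil] by (rule rev_finite_subset) (auto simp: c_def)
  have c: "is_forest H \<and> in_Zt (c H)" if "H \<in> ?S" for H
    using that by (auto simp: c_def in_Zt_coef split: if_splits)
  \<comment> \<open>The difference is nilpotent and all its coefficients vanish.\<close>
  have "f - (\<Sum>H\<in>?S. c H * dfp H) = 0"
  proof -
    have "\<exists>d. nilpotent d id (\<Sum>H\<in>?S. c H * dfp H)"
    proof (rule nilpotent_sum)
      fix H assume "H \<in> ?S"
      from c[OF this] show "\<exists>d. nilpotent d id (c H * dfp H)"
        using nilpotent_scale[OF xsub_in_Zt] nilpotent_homog[OF homog_dfp] by blast
    qed
    then obtain d where d: "nilpotent d id (\<Sum>H\<in>?S. c H * dfp H)" ..
    have "nilpotent (max d (Suc (fsize F + fsize G))) id (f - (\<Sum>H\<in>?S. c H * dfp H))"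
      by (rule nilpotent_diff[OF nilpotent_mono[OF _ nil] nilpotent_mono[OF _ d]]) simp_all
    moreover have "coef id K (f - (\<Sum>H\<in>?S. c H * dfp H)) = 0" if "is_forest K" for K
      using that coef_expansion[OF fin c that] by (simp add: coef_diff c_def)
    ultimately show ?thesis by (rule nilpotent_eq_0)
  qed
  then have existence: "f = (\<Sum>H\<in>?S. c H * dfp H)" by simp
  have "positive id f"
    using positive_mult[of id "dfp F" "dfp G"] positive_dfp[of _ id] assms
    by (simp add: f_def strict_mono_def)
  \<comment> \<open>The coefficients of any expansion are forced to be those read off by
    \<open>coef id\<close>, so they inherit the positivity of f.\<close>
  have positivity: "graham_positive (e K)"
    if e: "finite {H. e H \<noteq> 0}" "\<forall>H. e H \<noteq> 0 \<longrightarrow> is_forest H \<and> in_Zt (e H)"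
      and f: "f = (\<Sum>H\<in>{H. e H \<noteq> 0}. e H * dfp H)" and K: "is_forest K" for e K
  proof -
    have "coef id K f = e K"
      unfolding f using e K by (subst coef_expansion) auto
    then show ?thesis using \<open>positive id f\<close> K unfolding positive_def by metis
  qed
  show ?thesis
    unfolding DFP_eq_dfp f_def[symmetric]
  proof (intro conjI exI[of _ c] allI impI)
    show "finite ?S" by (fact fin)
    show "f = (\<Sum>H\<in>?S. c H * dfp H)" by (fact existence)
    show "is_forest H" "in_Zt (c H)" if "c H \<noteq> 0" for H using c that by auto
    show "graham_positive (e K)"
      if "finite {H. e H \<noteq> 0} \<and> (\<forall>H. e H \<noteq> 0 \<longrightarrow> is_forest H \<and> in_Zt (e H)) \<and>
        f = (\<Sum>H\<in>{H. e H \<noteq> 0}. e H * dfp H)" "is_forest K" for e K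
      using that by (elim conjE) (rule positivity)
  qed
qed

end
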